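(* Let $p$ be an odd prime and let $G$ be a finite $p$-group such that $G_3\cong C_p$, $\Phi(G')G_3\cong C_p^2$, $G/\Phi(G')G_3\cong M_p(n,m,1)$ and the type of the abelian group $C_G(G')/\Phi(G')G_3$ is $(p^n,p^{m-1},p)$, where $n\ge m\ge2$. Let $w(G)=(w_{ij})$ be a characteristic matrix of $G$. Then: (1) $I_{\min}\ge2$; that is, $G$ does not have an $\mathcal{A}_1$-subgroup of index $p$. (2) $I_{\max}\ge n$. (3) $I_{\max}=2$ if and only if $n=m=2$ and one of the following holds: (i) $w_{11}=w_{12}=0$ and $w_{22}\ne0$; (ii) $w_{11}^2-4w_{12}$ is a quadratic non-residue modulo $p$.
   Context: All groups are finite $p$-groups; $G_3=[G',G]$, $\Phi(H)$ is the Frattini subgroup of $H$, $[x,y]=x^{-1}y^{-1}xy$. An $\mathcal{A}_1$-group is a minimal non-abelian $p$-group. For a finite non-abelian $p$-group $G$, $p^{I_{\min}}$ and $p^{I_{\max}}$ denote the minimal and the maximal index in $G$ of the $\mathcal{A}_1$-subgroups of $G$. $M_p(n,m,1)=\langle a,b,c\mid a^{p^n}=b^{p^m}=c^p=1,\ [a,b]=c,\ [c,a]=[c,b]=1\rangle$. An abelian group has type $(p^{e_1},p^{e_2},p^{e_3})$ if it is isomorphic to $C_{p^{e_1}}\times C_{p^{e_2}}\times C_{p^{e_3}}$. Characteristic matrix: under the hypotheses one can choose $a,b\in G$ whose images $\tilde a,\tilde b$ in $G/\Phi(G')G_3\cong M_p(n,m,1)$ are generators satisfying, with $\tilde c=[\tilde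 a,\tilde b]$, the relations $\tilde a^{p^n}=\tilde b^{p^m}=\tilde c^p=1$, $[\tilde c,\tilde a]=[\tilde c,\tilde b]=1$ (image of $a$ of order $p^n$, image of $b$ of order $p^m$) and such that, with $c=[a,b]$, one has $[a,c]=1$ and $[b,c]\ne1$. Put $x=[b,c]$, so $G_3=\langle x\rangle$; $c$ has order $p^2$ and $\Phi(G')G_3=\langle c^p\rangle\times\langle x\rangle$. There are $w_{ij}\in F_p$ (the field with $p$ elements) with $a^{p^n}=c^{w_{11}p}x^{w_{12}}$ and $b^{p^m}=c^{w_{21}p}x^{w_{22}}$. The matrix $w(G)=(w_{ij})$ is called a characteristic matrix of $G$ (it depends on the choice of $a,b$). *)

theory Defs
  imports
    "HOL-Analysis.Finite_Cartesian_Product"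
    "HOL-Algebra.Elementary_Groups"
    "HOL-Number_Theory.Residues"
begin

section \<open>Group presentations\<close>

text \<open>A word over the generators \<open>'g\<close> is a list of signed letters: \<open>(s, True)\<close> stands for
  \<open>s\<close> and \<open>(s, False)\<close> for the inverse of \<open>s\<close>.\<close>

type_synonym 'g word = "('g \<times> bool) list"

definition word_inv :: "'g word \<Rightarrow> 'g word" where
  "word_inv u = rev (map (\<lambda>(s, e). (s, \<not> e)) u)"

definition word_pow :: "'g word \<Rightarrow> nat \<Rightarrow> 'g word" where
  "word_pow u k = concat (replicate k u)"

definition word_comm :: "'g word \<Rightarrow> 'g word \<Rightarrow> 'g word" where
  "word_comm u v = word_inv u @ word_inv v @ u @ v"

inductive word_eq :: "('g word \<times> 'g word) set \<Rightarrow> 'g word \<Rightarrow> 'g word \<Rightarrow> bool"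
  for R :: "('g word \<times> 'g word) set" where
  refl: "word_eq R u u"
| sym: "word_eq R u v \<Longrightarrow> word_eq R v u"
| trans: "word_eq R u v \<Longrightarrow> word_eq R v w \<Longrightarrow> word_eq R u w"
| cancel: "word_eq R (u @ [(s, e), (s, \<not> e)] @ v) (u @ v)"
| relation: "(l, r) \<in> R \<Longrightarrow> word_eq R (u @ l @ v) (u @ r @ v)"

text \<open>The group with generating set the whole type \<open>'g\<close> and defining relations \<open>l = r\<close> for
  \<open>(l, r) \<in> R\<close>, that is, words modulo the congruence generated by free cancellation and \<open>R\<close>.\<close>

definition presented_group :: "('g word \<times> 'g word) set \<Rightarrow> 'g word set monoid" where
  "presented_group R =
    \<lparr>carrier = UNIV // {(u, v). word_eq R u v},
     monoid.mult = (\<lambda>A B. {w. \<exists>u\<in>A. \<exists>v\<in>B. word_eq R (u @ v) w}),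
     one = {w. word_eq R [] w}\<rparr>"

lemma word_eq_append_left: "word_eq R u v \<Longrightarrow> word_eq R (t @ u) (t @ v)"
proof (induction rule: word_eq.induct)
  case (cancel u s e v)
  show ?case using word_eq.cancel[of R "t @ u" s e v] by simp
next
  case (relation l r u v)
  then show ?case using word_eq.relation[of l r R "t @ u" v] by simp
qed (auto intro: word_eq.refl word_eq.sym word_eq.trans)

lemma word_eq_append_right: "word_eq R u v \<Longrightarrow> word_eq R (u @ t) (v @ t)"
proof (induction rule: word_eq.induct)
  case (cancel u s e v)
  show ?case using word_eq.cancel[of R u s e "v @ t"] by simp
next
  case (relation l r u v)
  then show ?case using word_eq.relation[of l r R u "v @ t"] by simp
qed (auto intro: word_eq.refl word_eq.sym word_eq.trans)

lemma word_eq_append: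
  "word_eq R u u' \<Longrightarrow> word_eq R v v' \<Longrightarrow> word_eq R (u @ v) (u' @ v')"
  by (meson word_eq.trans word_eq_append_left word_eq_append_right)

lemma word_eq_inv: "word_eq R (word_inv u @ u) []"
proof (induction u)
  case Nil
  show ?case by (simp add: word_inv_def word_eq.refl)
next
  case (Cons x u)
  obtain s e where x: "x = (s, e)" by (cases x)
  have "word_eq R (word_inv u @ [(s, \<not> e), (s, \<not> \<not> e)] @ u) (word_inv u @ u)"
    by (rule word_eq.cancel)
  with Cons show ?case
    by (auto simp: word_inv_def x intro: word_eq.trans)
qed

lemma presented_group_mult_class:
  "{w. word_eq R u w} \<otimes>\<^bsub>presented_group R\<^esub> {w. word_eq R v w} = {w. word_eq R (u @ v) w}"
  unfolding presented_group_def
  by (auto intro: word_eq.refl word_eq.trans word_eq_append)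

lemma presented_group_carrier:
  "carrier (presented_group R) = range (\<lambda>u. {w. word_eq R u w})"
  by (auto simp: presented_group_def quotient_def)

lemma presented_group_one: "\<one>\<^bsub>presented_group R\<^esub> = {w. word_eq R [] w}"
  by (simp add: presented_group_def)

lemma group_presented_group: "group (presented_group R)"
proof (rule groupI)
  fix x assume "x \<in> carrier (presented_group R)"
  then obtain u where x: "x = {w. word_eq R u w}" by (auto simp: presented_group_carrier)
  have "{w. word_eq R (word_inv u @ u) w} = {w. word_eq R [] w}"
    by (meson word_eq.sym word_eq.trans word_eq_inv)
  then show "\<exists>y\<in>carrier (presented_group R). y \<otimes>\<^bsub>presented_group R\<^esub> x = \<one>\<^bsub>presented_group R\<^esub>"
    by (intro bexI[of _ "{w. word_eq R (word_inv u) w}"])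
      (auto simp: x presented_group_mult_class presented_group_one presented_group_carrier)
qed (auto simp: presented_group_carrier presented_group_mult_class presented_group_one)

datatype abc = gen_a | gen_b | gen_c

definition M_relations :: "nat \<Rightarrow> nat \<Rightarrow> nat \<Rightarrow> (abc word \<times> abc word) set" where
  "M_relations p n m =
    (let a = [(gen_a, True)]; b = [(gen_b, True)]; c = [(gen_c, True)] in
      {(word_pow a (p ^ n), []), (word_pow b (p ^ m), []), (word_pow c p, []),
       (word_comm a b, c), (word_comm c a, []), (word_comm c b, [])})"

definition M_group :: "nat \<Rightarrow> nat \<Rightarrow> nat \<Rightarrow> abc word set monoid" where
  "M_group p n m = presented_group (M_relations p n m)"


section \<open>Subgroups, $p$-groups and $\mathcal{A}_1$-subgroups\<close>

definition finite_p_group :: "nat \<Rightarrow> ('a, 'b) monoid_scheme \<Rightarrow> bool" where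
  "finite_p_group p G \<longleftrightarrow> group G \<and> finite (carrier G) \<and> (\<exists>k. order G = p ^ k)"

text \<open>The convention is $[x,y] = x^{-1}y^{-1}xy$, unlike in \<^const>\<open>derived\<close>, which uses
  $xyx^{-1}y^{-1}$; the derived subgroup is the same for both.\<close>

definition commutator :: "('a, 'b) monoid_scheme \<Rightarrow> 'a \<Rightarrow> 'a \<Rightarrow> 'a" where
  "commutator G x y = inv\<^bsub>G\<^esub> x \<otimes>\<^bsub>G\<^esub> inv\<^bsub>G\<^esub> y \<otimes>\<^bsub>G\<^esub> x \<otimes>\<^bsub>G\<^esub> y"

definition commutator_subgroup :: "('a, 'b) monoid_scheme \<Rightarrow> 'a set \<Rightarrow> 'a set \<Rightarrow> 'a set" where
  "commutator_subgroup G H K = generate G {commutator G h k | h k. h \<in> H \<and> k \<in> K}"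

definition G3 :: "('a, 'b) monoid_scheme \<Rightarrow> 'a set" where
  "G3 G = commutator_subgroup G (derived G (carrier G)) (carrier G)"

definition maximal_subgroup :: "'a set \<Rightarrow> ('a, 'b) monoid_scheme \<Rightarrow> bool" where
  "maximal_subgroup M G \<longleftrightarrow> subgroup M G \<and> M \<noteq> carrier G \<and>
     (\<forall>K. subgroup K G \<and> M \<subseteq> K \<longrightarrow> K = M \<or> K = carrier G)"

definition frattini :: "('a, 'b) monoid_scheme \<Rightarrow> 'a set" where
  "frattini G = carrier G \<inter> \<Inter>{M. maximal_subgroup M G}"

definition centralizer :: "('a, 'b) monoid_scheme \<Rightarrow> 'a set \<Rightarrow> 'a set" where
  "centralizer G H = {g \<in> carrier G. \<forall>h\<in>H. g \<otimes>\<^bsub>G\<^esub> h = h \<otimes>\<^bsub>G\<^esub> g}"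

text \<open>The subgroup $\Phi(G')G_3$.\<close>

definition PhiG3 :: "('a, 'b) monoid_scheme \<Rightarrow> 'a set" where
  "PhiG3 G = frattini (G\<lparr>carrier := derived G (carrier G)\<rparr>) <#>\<^bsub>G\<^esub> G3 G"

definition A1_group :: "nat \<Rightarrow> ('a, 'b) monoid_scheme \<Rightarrow> bool" where
  "A1_group p H \<longleftrightarrow> finite_p_group p H \<and> \<not> comm_group H \<and>
     (\<forall>K. subgroup K H \<and> K \<noteq> carrier H \<longrightarrow> comm_group (H\<lparr>carrier := K\<rparr>))"

definition A1_subgroup :: "nat \<Rightarrow> 'a set \<Rightarrow> ('a, 'b) monoid_scheme \<Rightarrow> bool" where
  "A1_subgroup p H G \<longleftrightarrow> subgroup H G \<and> A1_group p (G\<lparr>carrier := H\<rparr>)"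

definition subgroup_index :: "('a, 'b) monoid_scheme \<Rightarrow> 'a set \<Rightarrow> nat" where
  "subgroup_index G H = card (rcosets\<^bsub>G\<^esub> H)"

definition A1_indices :: "nat \<Rightarrow> ('a, 'b) monoid_scheme \<Rightarrow> nat set" where
  "A1_indices p G = {subgroup_index G H | H. A1_subgroup p H G}"

text \<open>A finite non-abelian $p$-group has an $\mathcal{A}_1$-subgroup and all indices are powers of
  \<open>p\<close>, so \<open>I_min\<close> and \<open>I_max\<close> are well defined for such groups.\<close>

definition I_min :: "nat \<Rightarrow> ('a, 'b) monoid_scheme \<Rightarrow> nat" where
  "I_min p G = (THE i. p ^ i = Min (A1_indices p G))"

definition I_max :: "nat \<Rightarrow> ('a, 'b) monoid_scheme \<Rightarrow> nat" where
  "I_max p G = (THE i. p ^ i = Max (A1_indices p G))"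


section \<open>Characteristic matrices\<close>

definition char_generators ::
    "('a, 'b) monoid_scheme \<Rightarrow> nat \<Rightarrow> nat \<Rightarrow> nat \<Rightarrow> 'a \<Rightarrow> 'a \<Rightarrow> bool" where
  "char_generators G p n m a b \<longleftrightarrow>
    (let N = PhiG3 G; Q = G Mod N; a' = N #>\<^bsub>G\<^esub> a; b' = N #>\<^bsub>G\<^esub> b; c' = commutator Q a' b';
         c = commutator G a b in
      a \<in> carrier G \<and> b \<in> carrier G \<and>
      generate Q {a', b'} = carrier Q \<and>
      a' [^]\<^bsub>Q\<^esub> (p ^ n) = \<one>\<^bsub>Q\<^esub> \<and> b' [^]\<^bsub>Q\<^esub> (p ^ m) = \<one>\<^bsub>Q\<^esub> \<and> c' [^]\<^bsub>Q\<^esub> p = \<one>\<^bsub>Q\<^esub> \<and>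
      commutator Q c' a' = \<one>\<^bsub>Q\<^esub> \<and> commutator Q c' b' = \<one>\<^bsub>Q\<^esub> \<and>
      group.ord Q a' = p ^ n \<and> group.ord Q b' = p ^ m \<and>
      commutator G a c = \<one>\<^bsub>G\<^esub> \<and> commutator G b c \<noteq> \<one>\<^bsub>G\<^esub>)"

text \<open>The entries of \<open>w\<close> are arbitrary integer representatives of elements of $F_p$; statements
  about the entries have to be read modulo \<open>p\<close>.\<close>

definition char_matrix ::
    "('a, 'b) monoid_scheme \<Rightarrow> nat \<Rightarrow> nat \<Rightarrow> nat \<Rightarrow> int ^ 2 ^ 2 \<Rightarrow> bool" where
  "char_matrix G p n m w \<longleftrightarrow>
    (\<exists>a b. char_generators G p n m a b \<and>
      (let c = commutator G a b; x = commutator G b c in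
        a [^]\<^bsub>G\<^esub> (p ^ n) = c [^]\<^bsub>G\<^esub> (w $ 1 $ 1 * int p) \<otimes>\<^bsub>G\<^esub> x [^]\<^bsub>G\<^esub> (w $ 1 $ 2) \<and>
        b [^]\<^bsub>G\<^esub> (p ^ m) = c [^]\<^bsub>G\<^esub> (w $ 2 $ 1 * int p) \<otimes>\<^bsub>G\<^esub> x [^]\<^bsub>G\<^esub> (w $ 2 $ 2)))"

end

(* Put c = [a,b] and x = [b,c]. Counting elements of C_G(G') shows that b^j a^i c^k x^l is a normal
   form, with j, i, k, l taken modulo p^m, p^n, p^2, p. The subgroup <a,c,x> is abelian and b acts
   on it by a -> ac, c -> cx^-1.

   An A_1-subgroup is generated by any two of its non-commuting elements, and conversely <g,h> is
   an A_1-subgroup as soon as [h,g] has order p and commutes with g and h. An A_1-subgroup of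
   index p would contain c, and would then be one of <a,b^p> and <g,c> with g outside C_G(G'); the
   first misses c and the second misses a^p. The subgroup <b,c> gives I_max >= n.

   Let n = m = 2. An A_1-subgroup contained in C_G(G') contains c^p, a^(p^2) and b^(p^2), so its
   index is p^2 unless w12 = w22 = 0. Any other A_1-subgroup is <g,h> with g = b a^i c^k x^l and
   h = a^(pr) c^t x^u. Its intersection with <c^p,x> is spanned by [h,g], h^p and g^(p^2), that is,
   in the coordinates (c^p, x), by (r,-t), (w11 r + t, w12 r) and (w21 + i w11, w22 + i w12). The
   index is at most p^2 iff this span is everything. The determinant of the first two vectors is
   t^2 + w11 r t + w12 r^2, whose discriminant is w11^2 - 4 w12. *)

theory Submission
  imports Defs
begin

section \<open>Powers, cosets and minimal non-abelian subgroups\<close>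

text \<open>The relations alone only bound \<open>order G\<close> above by
  \<open>p ^ (n + m + 3)\<close>. The matching lower bound comes from \<open>C_G(G')\<close>: the
  type of its quotient gives it order \<open>p ^ (n + m + 2)\<close>, and it is proper because it
  misses \<open>b\<close>. Only then are coordinates unique, and the later arguments compare
  coordinates.

  Two obstacles shape these comparisons. Coordinates carry: \<open>a^(p^n)\<close> and
  \<open>b^(p^m)\<close> fall into \<open><c^p,x>\<close>, so unless the \<open>b\<close>- and
  \<open>a\<close>-exponents agree exactly, the \<open>c\<close>-exponent is known only modulo
  \<open>p\<close>. And powers of \<open>b a^i c^k x^l\<close> involve binomial coefficients up to
  \<open>(s choose 3)\<close>; \<open>p\<close> odd makes \<open>(p choose 2)\<close> divisible by
  \<open>p\<close>, and \<open>(p^2 choose 3)\<close> is divisible by \<open>p\<close> even for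
  \<open>p = 3\<close>, where \<open>(p choose 3)\<close> is not.

  The bound \<open>p ^ 5\<close> below is index \<open>p^2\<close> in a group of order
  \<open>p^7\<close> (\<open>n = m = 2\<close>): \<open>p^3\<close> cosets of
  \<open><c^p,x>\<close>, and all of that subgroup. If the determinant vanishes and
  \<open>w11 = w12 = 0\<close>, then \<open>t = 0\<close>; the first two vectors give only
  \<open>c^p\<close>, and \<open>w22\<close> nonzero supplies \<open>x\<close>. This is the origin
  of condition (i).\<close>

context group
begin

text \<open>Conjugation by \<open>b\<close> is a homomorphism, so it respects powers; negative
  exponents come from inverting the relation for positive ones. The collection rules below all move
  powers past an element in this way.\<close>

lemma int_pow_semiconj:
  assumes [simp]: "b \<in> carrier G" "y \<in> carrier G" "y' \<in> carrier G" and yb: "y \<otimes> b = b \<otimes> y'"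
  shows "y [^] (i::int) \<otimes> b = b \<otimes> y' [^] i"
proof -
  have nat: "y [^] (k::nat) \<otimes> b = b \<otimes> y' [^] k" for k
  proof (induction k)
    case (Suc k)
    have "y [^] Suc k \<otimes> b = y [^] k \<otimes> (b \<otimes> y')" by (simp add: m_assoc yb)
    also have "\<dots> = (y [^] k \<otimes> b) \<otimes> y'" by (simp add: m_assoc)
    also have "\<dots> = b \<otimes> y' [^] Suc k" by (simp add: Suc m_assoc)
    finally show ?case .
  qed simp
  show ?thesis
  proof (cases i)
    case (nonneg k)
    then show ?thesis by (simp add: int_pow_int nat)
  next
    case (neg k)
    have "b = (b \<otimes> y' [^] Suc k) \<otimes> inv (y' [^] Suc k)"
      by (simp add: m_assoc del: nat_pow_Suc)
    also have "\<dots> = y [^] Suc k \<otimes> (b \<otimes> inv (y' [^] Suc k))"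
      by (simp only: nat[symmetric]) (simp add: m_assoc del: nat_pow_Suc)
    finally have "inv (y [^] Suc k) \<otimes> b = b \<otimes> inv (y' [^] Suc k)"
      by (simp add: inv_solve_left' del: nat_pow_Suc)
    then show ?thesis by (simp only: neg int_pow_neg_int assms)
  qed
qed

lemma int_pow_commute:
  assumes "y \<in> carrier G" "z \<in> carrier G" "y \<otimes> z = z \<otimes> y"
  shows "y [^] (i::int) \<otimes> z [^] (j::int) = z [^] j \<otimes> y [^] i"
  by (metis assms int_pow_closed int_pow_semiconj)

text \<open>In a finite group every inverse is a positive power, so closure under products
  suffices.\<close>

lemma finite_closed_subgroup:
  assumes "finite (carrier G)" "S \<subseteq> carrier G" "S \<noteq> {}"
    and cl: "\<And>u v. u \<in> S \<Longrightarrow> v \<in> S \<Longrightarrow> u \<otimes> v \<in> S"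
  shows "subgroup S G"
proof (rule subgroupI)
  fix u assume u: "u \<in> S"
  then have uc: "u \<in> carrier G" using assms by auto
  have pw: "u [^] Suc k \<in> S" for k
    by (induction k) (use u cl in \<open>auto simp: uc\<close>)
  have op: "order G > 0" using assms(1) by (simp add: order_gt_0_iff_finite)
  \<comment> \<open>Doubling the order keeps the exponent positive for the trivial group too;
    \<open>pw\<close> covers positive exponents only.\<close>
  have "u \<otimes> u [^] (2 * order G - 1) = u [^] Suc (2 * order G - 1)"
    using uc by (metis nat_pow_Suc2)
  also have "Suc (2 * order G - 1) = order G * 2" using op by simp
  also have "u [^] (order G * 2) = \<one>" using pow_order_eq_1[OF uc]
    by (metis nat_pow_pow nat_pow_one uc)
  finally have "inv u = u [^] (2 * order G - 1)"
    using uc by (metis inv_equality nat_pow_closed inv_comm)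
  moreover have "2 * order G - 1 = Suc (2 * order G - 2)" using op by simp
  ultimately show "inv u \<in> S" using pw by metis
qed (use assms in auto)

lemma subgroup_pow_coprime:
  assumes H: "subgroup H G" and y: "y \<in> carrier G" and e: "y [^] (e::int) = \<one>"
    and yk: "y [^] (k::int) \<in> H" and cop: "coprime k e"
  shows "y \<in> H"
proof -
  obtain s t where st: "s * k + t * e = 1"
    using cop bezout_int[of k e] by (metis coprime_imp_gcd_eq_1)
  have "y = y [^] (k * s + e * t)" using st y by (simp add: mult.commute)
  also have "\<dots> = (y [^] k) [^] s \<otimes> (y [^] e) [^] t" using y by (simp add: int_pow_mult int_pow_pow)
  also have "\<dots> = (y [^] k) [^] s" using y e by simp
  finally show ?thesis using subgroup_int_pow_closed[OF H yk] by metis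
qed

lemma subgroup_mult_cancel:
  assumes "subgroup H G" "u \<in> H" "u \<otimes> z \<in> H" "z \<in> carrier G"
  shows "z \<in> H"
proof -
  have "u \<in> carrier G" using assms(1,2) subgroup.subset by blast
  then have "z = inv u \<otimes> (u \<otimes> z)" using assms(4) by (simp flip: m_assoc)
  then show ?thesis using assms(1-3) by (metis subgroup.m_closed subgroup.m_inv_closed)
qed

lemma index_mult_card:
  assumes "subgroup H G"
  shows "subgroup_index G H * card H = order G"
  using lagrange[OF assms] by (simp add: subgroup_index_def)

end

section \<open>Exponents, minimal non-abelian subgroups and cosets in a group of order
  \<open>p ^ e\<close>\<close>

locale prime_power_group = group G for G (structure) +
  fixes p e :: nat
  assumes prime_p: "Factorial_Ring.prime p" and fin: "finite (carrier G)" and order_eq: "order G = p ^ e"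
begin

lemma p_gt_1: "p > 1" using prime_p by (rule prime_gt_1_nat)

lemma pow_exponent: "y \<in> carrier G \<Longrightarrow> y [^] (int p ^ e) = \<one>"
  using pow_order_eq_1[of y] by (simp add: order_eq flip: int_pow_int)

lemma prime_int: "Factorial_Ring.prime (int p)" using prime_p by simp

lemma coprime_prime_power: "\<not> int p dvd k \<Longrightarrow> coprime k (int p ^ s)"
  using prime_int by (metis coprime_commute coprime_power_right_iff prime_imp_coprime)

text \<open>An exponent prime to \<open>p\<close> is invertible modulo the order of any element, so
  \<open>y\<close> is a power of \<open>y^k\<close>. This is how generators are recovered from
  subgroups throughout.\<close>

lemma subgroup_pow_unit:
  assumes "subgroup H G" "y \<in> carrier G" "y [^] (k::int) \<in> H" "\<not> int p dvd k"
  shows "y \<in> H"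
  using subgroup_pow_coprime[OF assms(1,2) pow_exponent[OF assms(2)] assms(3)]
    coprime_prime_power[OF assms(4)] by blast

lemma pow_eq_one_iff:
  assumes z: "z \<in> carrier G" and zp: "z [^] p = \<one>" and "z \<noteq> \<one>"
  shows "z [^] (k::int) = \<one> \<longleftrightarrow> int p dvd k"
proof
  assume "z [^] k = \<one>"
  then show "int p dvd k"
    using subgroup_pow_unit[OF triv_subgroup z, of k] \<open>z \<noteq> \<one>\<close> by auto
next
  assume "int p dvd k"
  then obtain r where "k = int p * r" by blast
  then show "z [^] k = \<one>" using z zp by (metis int_pow_int int_pow_one int_pow_pow)
qed

lemma finite_p_group_subgroup:
  assumes "subgroup H G"
  shows "finite_p_group p (G\<lparr>carrier := H\<rparr>)"
proof -
  have "card H dvd p ^ e" using lagrange[OF assms] by (metis dvd_triv_right order_eq)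
  then have "\<exists>k. card H = p ^ k" using prime_p divides_primepow_nat by blast
  moreover have "finite H" using assms fin by (meson finite_subset subgroup.subset)
  ultimately show ?thesis
    using subgroup_imp_group[OF assms] by (simp add: finite_p_group_def order_def)
qed

lemma index_prime_power:
  assumes "subgroup H G"
  obtains k where "subgroup_index G H = p ^ k"
proof -
  have "subgroup_index G H dvd p ^ e"
    using index_mult_card[OF assms] by (metis dvd_triv_left order_eq)
  then show ?thesis using that prime_p divides_primepow_nat by blast
qed

text \<open>Minimality is phrased contrapositively and inside \<open>G\<close>: a single
  non-commuting pair of \<open>K\<close> must already force \<open>K = H\<close>. This avoids the
  relativized group structure in applications.\<close>

lemma A1_subgroupI:
  assumes H: "subgroup H G"
    and nc: "\<exists>u\<in>H. \<exists>v\<in>H. u \<otimes> v \<noteq> v \<otimes> u"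
    and min: "\<And>K u v. subgroup K G \<Longrightarrow> K \<subseteq> H \<Longrightarrow> u \<in> K \<Longrightarrow> v \<in> K \<Longrightarrow> u \<otimes> v \<noteq> v \<otimes> u \<Longrightarrow> H \<subseteq> K"
  shows "A1_subgroup p H G"
proof -
  have "comm_group (G\<lparr>carrier := K\<rparr>)"
    if "subgroup K (G\<lparr>carrier := H\<rparr>)" "K \<noteq> H" for K
  proof -
    have KH: "K \<subseteq> H" using that(1) subgroup.subset by fastforce
    have KG: "subgroup K G" using incl_subgroup[OF H that(1)] .
    have "u \<otimes> v = v \<otimes> u" if "u \<in> K" "v \<in> K" for u v
      using min[OF KG KH that] KH \<open>K \<noteq> H\<close> by blast
    moreover have "group (G\<lparr>carrier := K\<rparr>)" using KG by (rule subgroup_imp_group)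
    ultimately show ?thesis by (intro group.group_comm_groupI) auto
  qed
  moreover have "\<not> comm_group (G\<lparr>carrier := H\<rparr>)"
    using nc comm_groupE(4)[of "G\<lparr>carrier := H\<rparr>"] by auto
  ultimately show ?thesis
    using H finite_p_group_subgroup[OF H] by (auto simp: A1_subgroup_def A1_group_def)
qed

lemma A1_subgroup_nonabelian:
  assumes "A1_subgroup p H G"
  obtains u v where "u \<in> H" "v \<in> H" "u \<otimes> v \<noteq> v \<otimes> u"
proof -
  have H: "subgroup H G" and "\<not> comm_group (G\<lparr>carrier := H\<rparr>)"
    using assms by (auto simp: A1_subgroup_def A1_group_def)
  moreover have "group (G\<lparr>carrier := H\<rparr>)" using H by (rule subgroup_imp_group)
  ultimately show ?thesis using that group.group_comm_groupI[of "G\<lparr>carrier := H\<rparr>"] by auto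
qed

lemma A1_subgroup_minimal:
  assumes "A1_subgroup p H G" "subgroup K G" "K \<subseteq> H" "u \<in> K" "v \<in> K" "u \<otimes> v \<noteq> v \<otimes> u"
  shows "K = H"
proof (rule ccontr)
  assume "K \<noteq> H"
  have "subgroup K (G\<lparr>carrier := H\<rparr>)"
    using assms by (intro subgroup_incl) (auto simp: A1_subgroup_def)
  then have "comm_group (G\<lparr>carrier := K\<rparr>)"
    using assms \<open>K \<noteq> H\<close> by (auto simp: A1_subgroup_def A1_group_def)
  then show False using assms comm_groupE(4)[of "G\<lparr>carrier := K\<rparr>"] by auto
qed

lemma A1_subgroup_generate:
  assumes "A1_subgroup p H G" "u \<in> H" "v \<in> H" "u \<otimes> v \<noteq> v \<otimes> u"
  shows "generate G {u, v} = H"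
proof -
  have H: "subgroup H G" using assms by (simp add: A1_subgroup_def)
  have "{u, v} \<subseteq> carrier G" using H assms subgroup.subset by fastforce
  then show ?thesis
    using assms(4) by (intro A1_subgroup_minimal[OF assms(1) generate_is_subgroup])
      (auto intro!: generate.incl generate_subgroup_incl[OF _ H] assms)
qed

lemma A1_indices_finite: "finite (A1_indices p G)"
proof -
  have "A1_indices p G \<subseteq> subgroup_index G ` Pow (carrier G)"
    by (auto simp: A1_indices_def A1_subgroup_def dest: subgroup.subset)
  then show ?thesis using fin by (meson finite_Pow_iff finite_imageI finite_subset)
qed

lemma A1_indices_prime_power:
  assumes "i \<in> A1_indices p G"
  obtains k where "i = p ^ k"
  using assms index_prime_power by (auto simp: A1_indices_def A1_subgroup_def)

text \<open>The exponent in the \<open>THE\<close> is unique because \<open>p > 1\<close>;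
  non-emptiness is required since \<open>Min\<close> of the empty set is unspecified.\<close>

lemma I_min_eq:
  assumes "A1_indices p G \<noteq> {}"
  shows "p ^ I_min p G = Min (A1_indices p G)"
proof -
  obtain k where "Min (A1_indices p G) = p ^ k"
    using A1_indices_prime_power Min_in[OF A1_indices_finite assms] by blast
  then show ?thesis using p_gt_1 unfolding I_min_def by (metis (mono_tags, lifting) power_inject_exp the_equality)
qed

lemma I_max_eq:
  assumes "A1_indices p G \<noteq> {}"
  shows "p ^ I_max p G = Max (A1_indices p G)"
proof -
  obtain k where "Max (A1_indices p G) = p ^ k"
    using A1_indices_prime_power Max_in[OF A1_indices_finite assms] by blast
  then show ?thesis using p_gt_1 unfolding I_max_def by (metis (mono_tags, lifting) power_inject_exp the_equality)
qed

text \<open>The cosets of \<open>y^s\<close> with \<open>s < p\<close> are pairwise distinct: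
  otherwise \<open>H\<close> would contain a power of \<open>y\<close> with exponent prime to
  \<open>p\<close>, hence \<open>y\<close>. With index at most \<open>p\<close> they exhaust all
  cosets.\<close>

lemma small_index_cosets:
  assumes H: "subgroup H G" and ind: "subgroup_index G H \<le> p"
    and y: "y \<in> carrier G" "y \<notin> H" and g: "g \<in> carrier G"
  obtains s h where "s < p" "h \<in> H" "g = h \<otimes> y [^] s"
proof -
  let ?f = "\<lambda>s::nat. H #> y [^] s"
  have Hc: "H \<subseteq> carrier G" using H subgroup.subset by blast
  have inj: "inj_on ?f {..<p}"
  proof (rule inj_onI)
    fix s t assume st: "s \<in> {..<p}" "t \<in> {..<p}" and eq: "?f s = ?f t"
    have "y [^] s \<in> ?f s" using y by (intro rcos_self[OF _ H]) auto
    then obtain h where h: "h \<in> H" "y [^] s = h \<otimes> y [^] t" using eq by (auto simp: r_coset_def)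
    then have "y [^] (int s - int t) = h"
      using y Hc by (auto simp: int_pow_diff int_pow_int inv_solve_right' subset_iff)
    then have "int p dvd int s - int t"
      using subgroup_pow_unit[OF H y(1)] h y by blast
    then have "int s mod int p = int t mod int p" by (simp add: mod_eq_dvd_iff)
    then show "s = t" using st by simp
  qed
  have "?f ` {..<p} \<subseteq> rcosets H" using y Hc by (auto simp: RCOSETS_def)
  moreover have "card (?f ` {..<p}) = p" using inj by (simp add: card_image)
  moreover have "finite (rcosets H)"
    using rcosets_part_G[OF H] fin finite_UnionD by metis
  ultimately have "?f ` {..<p} = rcosets H"
    using ind by (intro card_subset_eq) (auto simp: subgroup_index_def dest: card_mono)
  moreover have "H #> g \<in> rcosets H" using g Hc by (auto simp: RCOSETS_def)
  ultimately obtain s where s: "s < p" "H #> g = ?f s" by auto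
  have "g \<in> H #> g" using g by (intro rcos_self[OF _ H])
  then show ?thesis using s that by (auto simp: r_coset_def)
qed

text \<open>Normality of \<open>H\<close> is not invoked. If \<open>y\<close> is not in
  \<open>H\<close>, then \<open>y^p\<close> lies in the coset of some \<open>y^s\<close> with
  \<open>s < p\<close>, so \<open>y^(p-s)\<close> is in \<open>H\<close>; hence \<open>p\<close>
  divides \<open>p - s\<close> and \<open>s = 0\<close>.\<close>

lemma small_index_pow_p:
  assumes H: "subgroup H G" and ind: "subgroup_index G H \<le> p" and y: "y \<in> carrier G"
  shows "y [^] int p \<in> H"
proof (cases "y \<in> H")
  case True
  then show ?thesis using H subgroup_int_pow_closed by blast
next
  case False
  obtain s h where s: "s < p" "h \<in> H" "y [^] int p = h \<otimes> y [^] s"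
    using small_index_cosets[OF H ind y False, of "y [^] int p"] y by auto
  then have "y [^] (int p - int s) = h"
    using y subgroup.subset[OF H] by (auto simp: int_pow_diff int_pow_int inv_solve_right' subset_iff)
  then have "int p dvd int p - int s" using subgroup_pow_unit[OF H y] s False by blast
  then have "s = 0" using s(1) by (auto dest: zdvd_imp_le)
  then show ?thesis using s y subgroup.subset[OF H] by auto
qed

end

section \<open>Two elements with a central commutator\<close>

text \<open>Here \<open>z\<close> is \<open>[h,g]\<close>, in this order. It commutes with
  \<open>g\<close> and \<open>h\<close>, so it is central in \<open><g,h>\<close>, but not
  necessarily in \<open>G\<close>.\<close>

locale central_commutator = group G for G (structure) +
  fixes g h z
  assumes gc [simp]: "g \<in> carrier G" and hc [simp]: "h \<in> carrier G" and zc [simp]: "z \<in> carrier G"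
    and hg: "h \<otimes> g = g \<otimes> (h \<otimes> z)" and zg: "z \<otimes> g = g \<otimes> z" and zh: "z \<otimes> h = h \<otimes> z"
begin

definition word :: "int \<Rightarrow> int \<Rightarrow> int \<Rightarrow> 'a" where
  "word i j k = g [^] i \<otimes> (h [^] j \<otimes> z [^] k)"

lemma word_closed [simp]: "word i j k \<in> carrier G"
  by (simp add: word_def)

text \<open>Bilinearity of a central commutator. Since \<open>int_pow_semiconj\<close> moves powers
  of one element past a single other element, it is applied twice: first to \<open>h^j\<close> and
  \<open>g\<close>, then to \<open>g^i\<close> and \<open>h^j\<close>.\<close>

lemma h_pow_g_pow: "h [^] (j::int) \<otimes> g [^] (i::int) = g [^] i \<otimes> (h [^] j \<otimes> z [^] (j * i))"
proof -
  have "h [^] j \<otimes> g = g \<otimes> (h \<otimes> z) [^] j"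
    by (intro int_pow_semiconj) (simp_all add: hg)
  then have 1: "h [^] j \<otimes> g = g \<otimes> (h [^] j \<otimes> z [^] j)"
    by (simp add: int_pow_mult_distrib zh)
  have zj: "z [^] j \<otimes> h [^] j = h [^] j \<otimes> z [^] j" "z [^] j \<otimes> g = g \<otimes> z [^] j" for j :: int
    using int_pow_commute[OF zc hc zh] int_pow_semiconj[OF gc zc zc zg] by auto
  have "g \<otimes> h [^] j = h [^] j \<otimes> (g \<otimes> z [^] (- j))"
  proof -
    have "h [^] j \<otimes> (g \<otimes> z [^] (- j)) = g \<otimes> (h [^] j \<otimes> z [^] j) \<otimes> z [^] (- j)"
      by (simp add: 1 flip: m_assoc)
    also have "\<dots> = g \<otimes> h [^] j \<otimes> z [^] (j + - j)" by (subst int_pow_mult) (simp_all add: m_assoc)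
    finally show ?thesis by simp
  qed
  then have "g [^] i \<otimes> h [^] j = h [^] j \<otimes> (g \<otimes> z [^] (- j)) [^] i"
    by (intro int_pow_semiconj) auto
  also have "(g \<otimes> z [^] (- j)) [^] i = g [^] i \<otimes> z [^] (- (j * i))"
    by (subst int_pow_mult_distrib) (simp_all add: zj int_pow_pow)
  finally have 2: "g [^] i \<otimes> h [^] j = h [^] j \<otimes> (g [^] i \<otimes> z [^] (- (j * i)))" .
  have "g [^] i \<otimes> (h [^] j \<otimes> z [^] (j * i)) = (g [^] i \<otimes> h [^] j) \<otimes> z [^] (j * i)"
    by (simp add: m_assoc)
  also have "\<dots> = h [^] j \<otimes> g [^] i \<otimes> z [^] (- (j * i) + j * i)"
    by (subst int_pow_mult) (simp_all add: 2 m_assoc)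
  finally show ?thesis by simp
qed

text \<open>The multiplication of the integral Heisenberg group.\<close>

lemma word_mult: "word i j k \<otimes> word i' j' k' = word (i + i') (j + j') (k + k' + j * i')"
proof -
  have zh': "z [^] k \<otimes> h [^] j = h [^] j \<otimes> z [^] k" and zg': "z [^] k \<otimes> g [^] j = g [^] j \<otimes> z [^] k"
    for k j :: int using int_pow_commute zh zg by auto
  have zl: "z [^] k \<otimes> (h [^] j \<otimes> y) = h [^] j \<otimes> (z [^] k \<otimes> y)" if "y \<in> carrier G" for y and k j :: int
    using that by (simp add: zh' flip: m_assoc)
  have "word i j k \<otimes> word i' j' k'
      = g [^] i \<otimes> (h [^] j \<otimes> (z [^] k \<otimes> g [^] i') \<otimes> (h [^] j' \<otimes> z [^] k'))"
    by (simp add: word_def m_assoc)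
  also have "\<dots> = g [^] i \<otimes> ((h [^] j \<otimes> g [^] i') \<otimes> ((z [^] k \<otimes> h [^] j') \<otimes> z [^] k'))"
    by (simp add: zg' m_assoc)
  also have "\<dots> = g [^] i \<otimes> (g [^] i' \<otimes> (h [^] j \<otimes> ((z [^] (j * i') \<otimes> h [^] j') \<otimes> (z [^] k \<otimes> z [^] k'))))"
    by (simp add: zl h_pow_g_pow m_assoc)
  also have "\<dots> = (g [^] i \<otimes> g [^] i') \<otimes> ((h [^] j \<otimes> h [^] j') \<otimes> (z [^] (j * i') \<otimes> (z [^] k \<otimes> z [^] k')))"
    by (simp add: m_assoc zl)
  finally show ?thesis by (simp add: word_def int_pow_mult[symmetric] algebra_simps)
qed

lemma word_simps: "word 1 0 0 = g" "word 0 1 0 = h" "word 0 0 k = z [^] k" "word i 0 0 = g [^] i" "word 0 j 0 = h [^] j"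
  by (simp_all add: word_def)

text \<open>The \<open>z\<close>-exponent stays existential because its quadratic correction never
  matters: it is used only for subgroups that contain \<open>z\<close>.\<close>

lemma word_pow: "\<exists>k'. word i j k [^] (s::int) = word (i * s) (j * s) k'"
proof -
  have nat: "\<exists>k'. word i j k [^] (s::nat) = word (i * s) (j * s) k'" for s
  proof (induction s)
    case 0
    show ?case by (auto simp: word_def intro: exI[of _ 0])
  next
    case (Suc s)
    then obtain k' where "word i j k [^] s = word (i * s) (j * s) k'" by blast
    then show ?case by (auto simp: word_mult algebra_simps)
  qed
  show ?thesis
  proof (cases s)
    case (nonneg r)
    then show ?thesis using nat[of r] by (simp add: int_pow_int)
  next
    case (neg r)
    obtain k' where k': "word i j k [^] Suc r = word (i * Suc r) (j * Suc r) k'" using nat by blast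
    have "word (- (i * Suc r)) (- (j * Suc r)) (- k' + j * Suc r * (i * Suc r)) \<otimes> word (i * Suc r) (j * Suc r) k' = \<one>"
      by (simp add: word_mult) (simp add: word_def)
    then have "inv (word i j k [^] Suc r) = word (- (i * Suc r)) (- (j * Suc r)) (- k' + j * Suc r * (i * Suc r))"
      unfolding k' by (intro inv_equality) auto
    then have "word i j k [^] s = word (i * s) (j * s) (- k' + j * Suc r * (i * Suc r))"
      unfolding neg by (subst int_pow_neg_int) (auto simp del: nat_pow_Suc of_nat_Suc)
    then show ?thesis by blast
  qed
qed

end

locale central_commutator_p = central_commutator + prime_power_group +
  assumes zp: "z [^] p = \<one>"
begin

lemma generate_eq_words: "generate G {g, h} = {word i j k | i j k. True}"
proof
  let ?S = "{word i j k | i j k. True}"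
  have "subgroup ?S G"
    using fin by (intro finite_closed_subgroup) (auto simp: word_mult, blast)
  moreover have "{g, h} \<subseteq> ?S" using word_simps by (metis (mono_tags, lifting) insert_subset mem_Collect_eq empty_subsetI)
  ultimately show "generate G {g, h} \<subseteq> ?S" by (rule generate_subgroup_incl[rotated])
  have K: "subgroup (generate G {g, h}) G" by (rule generate_is_subgroup) auto
  have g: "g \<in> generate G {g, h}" and h: "h \<in> generate G {g, h}" by (auto intro: generate.incl)
  have "z = inv (g \<otimes> h) \<otimes> (h \<otimes> g)" by (simp add: hg inv_mult_group m_assoc) (simp flip: m_assoc)
  then have z: "z \<in> generate G {g, h}" using g h K
    by (metis subgroup.m_closed subgroup.m_inv_closed)
  show "?S \<subseteq> generate G {g, h}"
    using g h z K by (auto simp: word_def intro!: subgroup.m_closed[OF K] subgroup_int_pow_closed)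
qed

text \<open>For \<open>u\<close>, \<open>v\<close> in \<open><g,h>\<close> the commutator is
  \<open>z^d\<close>, where \<open>d\<close> is the determinant of their exponent vectors. If they
  do not commute, \<open>d\<close> is prime to \<open>p\<close>, so \<open>K\<close> contains
  \<open>z\<close> and can ignore \<open>z\<close>-exponents; linear algebra on the other two
  exponents then returns \<open>g\<close> and \<open>h\<close>.\<close>

lemma A1_subgroup_generate:
  assumes "z \<noteq> \<one>"
  shows "A1_subgroup p (generate G {g, h}) G"
proof (rule A1_subgroupI)
  show "subgroup (generate G {g, h}) G" by (rule generate_is_subgroup) auto
  have "h \<otimes> g \<noteq> g \<otimes> h" using assms by (simp add: hg flip: m_assoc)
  then show "\<exists>u\<in>generate G {g, h}. \<exists>v\<in>generate G {g, h}. u \<otimes> v \<noteq> v \<otimes> u"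
    by (meson generate.incl insertCI)
next
  fix K u v
  assume K: "subgroup K G" and KH: "K \<subseteq> generate G {g, h}" and u: "u \<in> K" and v: "v \<in> K"
    and uv: "u \<otimes> v \<noteq> v \<otimes> u"
  obtain i j k where ue: "u = word i j k" using u KH by (auto simp: generate_eq_words)
  obtain i' j' k' where ve: "v = word i' j' k'" using v KH by (auto simp: generate_eq_words)
  define d where "d = j * i' - j' * i"
  have "u \<otimes> v = (v \<otimes> u) \<otimes> z [^] d"
    unfolding ue ve word_mult word_simps(3)[symmetric] by (simp add: d_def algebra_simps)
  moreover from this have "\<not> int p dvd d"
    using uv pow_eq_one_iff[OF zc zp assms, of d] ue ve by auto
  moreover have "z [^] d = inv (v \<otimes> u) \<otimes> (u \<otimes> v)"
    using calculation(1) ue ve by (simp add: inv_solve_left)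
  ultimately have z: "z \<in> K"
    by (metis K subgroup.m_closed subgroup.m_inv_closed subgroup_pow_unit u v zc)
  have red: "word r s 0 \<in> K" if "word r s q \<in> K" for r s q
  proof -
    have "word r s 0 = word r s q \<otimes> z [^] (- q)"
      by (simp add: word_mult flip: word_simps(3))
    then show ?thesis using that z K by (metis subgroup.m_closed subgroup_int_pow_closed)
  qed
  have comb: "word (i * s + i' * s') (j * s + j' * s') 0 \<in> K" for s s'
  proof -
    obtain q q' where "u [^] s = word (i * s) (j * s) q" "v [^] s' = word (i' * s') (j' * s') q'"
      using word_pow ue ve by blast
    moreover have "u [^] s \<otimes> v [^] s' \<in> K" using u v K by (meson subgroup.m_closed subgroup_int_pow_closed)
    ultimately show ?thesis using red by (auto simp: word_mult)
  qed
  \<comment> \<open>Cramer's rule: these coefficients cancel the \<open>h\<close>-exponent, and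
    those of the next step cancel the \<open>g\<close>-exponent.\<close>
  have "g [^] (- d) \<in> K" using comb[of j' "- j"] by (simp add: word_simps d_def algebra_simps)
  moreover have "h [^] d \<in> K" using comb[of "i'" "- i"]
    by (simp add: word_simps d_def algebra_simps)
  ultimately have "{g, h} \<subseteq> K" using subgroup_pow_unit[OF K] \<open>\<not> int p dvd d\<close> by auto
  then show "generate G {g, h} \<subseteq> K" using K generate_subgroup_incl by blast
qed

text \<open>The exponents are reduced in the order \<open>g\<close>, \<open>h\<close>,
  \<open>z\<close>, since reducing \<open>g\<close> alters the other two and reducing
  \<open>h\<close> alters the last.\<close>

lemma card_generate_le:
  assumes "M > 0" "L > 0"
    and hL: "h [^] int L = z [^] (s::int)" and gM: "g [^] int M = h [^] (s'::int) \<otimes> z [^] (s''::int)"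
  shows "card (generate G {g, h}) \<le> M * L * p"
proof -
  let ?D = "{0..<int M} \<times> {0..<int L} \<times> {0..<int p}"
  let ?f = "\<lambda>(i, j, k). word i j k"
  have "generate G {g, h} \<subseteq> ?f ` ?D"
  proof
    fix y assume "y \<in> generate G {g, h}"
    then obtain i j k where y: "y = word i j k" by (auto simp: generate_eq_words)
    have zh': "z [^] k \<otimes> h [^] j = h [^] j \<otimes> z [^] k" for k j :: int
      using int_pow_commute zh by auto
    have "word i j k = word (i - int M * q) (j + s' * q) (k + s'' * q)" for i j k q
    proof -
      have "g [^] (int M * q) = h [^] (s' * q) \<otimes> z [^] (s'' * q)"
        by (simp add: int_pow_pow[symmetric] gM int_pow_mult_distrib zh')
      moreover have "g [^] i = g [^] (i - int M * q) \<otimes> g [^] (int M * q)"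
        by (simp flip: int_pow_mult)
      ultimately have "word i j k = word (i - int M * q) (s' * q) (s'' * q) \<otimes> word 0 j k"
        by (simp add: word_def m_assoc)
      then show ?thesis by (simp add: word_mult algebra_simps)
    qed
    from this[of i j k "i div int M"] obtain j k where "y = word (i mod int M) j k"
      using y by (auto simp: minus_mult_div_eq_mod)
    moreover define i' where "i' = i mod int M"
    ultimately have y: "y = word i' j k" by simp
    have i': "i' \<in> {0..<int M}" using \<open>M > 0\<close> by (simp add: i'_def)
    have "word i j k = word i (j - int L * q) (k + s * q)" for i j k q
    proof -
      have "h [^] (int L * q) = z [^] (s * q)"
        by (simp add: int_pow_pow[symmetric] hL)
      moreover have "h [^] j = h [^] (j - int L * q) \<otimes> h [^] (int L * q)"
        by (simp flip: int_pow_mult)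
      ultimately have "word i j k = word i (j - int L * q) (s * q) \<otimes> word 0 0 k"
        by (simp add: word_def m_assoc)
      then show ?thesis by (simp add: word_mult algebra_simps)
    qed
    from this[of i' j k "j div int L"] obtain k where "y = word i' (j mod int L) k"
      using y by (auto simp: minus_mult_div_eq_mod)
    moreover define j' where "j' = j mod int L"
    ultimately have y: "y = word i' j' k" by simp
    have j': "j' \<in> {0..<int L}" using \<open>L > 0\<close> by (simp add: j'_def)
    have "z [^] k = z [^] (k mod int p + int p * (k div int p))" by simp
    also have "\<dots> = z [^] (k mod int p) \<otimes> (z [^] int p) [^] (k div int p)"
      by (simp only: int_pow_mult int_pow_pow zc)
    also have "\<dots> = z [^] (k mod int p)" by (simp add: int_pow_int zp)
    finally have "y = word i' j' (k mod int p)" by (simp add: y word_def)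
    moreover have "k mod int p \<in> {0..<int p}" using p_gt_1 by simp
    ultimately show "y \<in> ?f ` ?D" using i' j' by force
  qed
  then have "card (generate G {g, h}) \<le> card ?D" by (meson surj_card_le finite_SigmaI finite_atLeastLessThan_int)
  then show ?thesis by (simp add: card_cartesian_product mult.assoc)
qed

end

section \<open>Normal form\<close>

text \<open>Three nested locales separate what is known when: first the relations alone, then that
  every element has coordinates and how they carry, last the exact order. The order bound derived in
  the second is needed to establish the third.\<close>

locale class3_relations = prime_power_group +
  fixes a b c x
  assumes odd_p: "odd p"
    and ca [simp]: "a \<in> carrier G" and cb [simp]: "b \<in> carrier G"
    and cc [simp]: "c \<in> carrier G" and cx [simp]: "x \<in> carrier G"
    and ab: "a \<otimes> b = b \<otimes> (a \<otimes> c)" and ac: "a \<otimes> c = c \<otimes> a"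
    and bc: "c \<otimes> b = b \<otimes> (c \<otimes> inv x)"
    and xa: "x \<otimes> a = a \<otimes> x" and xb: "x \<otimes> b = b \<otimes> x" and xc: "x \<otimes> c = c \<otimes> x"
    and c_pow: "c [^] (int p)\<^sup>2 = \<one>" and x_pow: "x [^] int p = \<one>"
begin

definition A :: "int \<Rightarrow> int \<Rightarrow> int \<Rightarrow> 'a" where
  "A i k l = a [^] i \<otimes> (c [^] k \<otimes> x [^] l)"

definition E :: "int \<Rightarrow> int \<Rightarrow> int \<Rightarrow> int \<Rightarrow> 'a" where
  "E j i k l = b [^] j \<otimes> A i k l"

lemma A_closed [simp]: "A i k l \<in> carrier G"
  by (simp add: A_def)

lemma E_closed [simp]: "E j i k l \<in> carrier G"
  by (simp add: E_def)

lemma E_simps: "E j 0 0 0 = b [^] j" "E 0 i 0 0 = a [^] i" "E 0 0 k 0 = c [^] k" "E 0 0 0 l = x [^] l"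
  "E 0 0 k l = c [^] k \<otimes> x [^] l"
  by (simp_all add: E_def A_def)

lemma E_gens: "E 1 0 0 0 = b" "E 0 1 0 0 = a" "E 0 0 1 0 = c" "E 0 0 0 1 = x" "E 0 0 0 0 = \<one>"
  by (simp_all add: E_def A_def)

lemma A_mult: "A i k l \<otimes> A i' k' l' = A (i + i') (k + k') (l + l')"
proof -
  have comm: "c [^] k \<otimes> (a [^] i \<otimes> y) = a [^] i \<otimes> (c [^] k \<otimes> y)"
    "x [^] k \<otimes> (a [^] i \<otimes> y) = a [^] i \<otimes> (x [^] k \<otimes> y)"
    "x [^] k \<otimes> (c [^] i \<otimes> y) = c [^] i \<otimes> (x [^] k \<otimes> y)"
    if "y \<in> carrier G" for y and k i :: int
    using that by (simp_all add: int_pow_commute ac xa xc flip: m_assoc)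
  show ?thesis by (simp add: A_def int_pow_mult m_assoc comm)
qed

lemma A_b: "A i k l \<otimes> b = b \<otimes> A i (k + i) (l - k)"
proof -
  have "a [^] i \<otimes> b = b \<otimes> (a \<otimes> c) [^] i" by (intro int_pow_semiconj) (simp_all add: ab)
  then have 1: "a [^] i \<otimes> b = b \<otimes> A i i 0"
    by (simp add: A_def int_pow_mult_distrib ac int_pow_commute)
  have "c [^] k \<otimes> b = b \<otimes> (c \<otimes> inv x) [^] k" by (intro int_pow_semiconj) (simp_all add: bc)
  also have "(c \<otimes> inv x) [^] k = c [^] k \<otimes> (inv x) [^] k"
  proof (rule int_pow_mult_distrib)
    have "x \<otimes> (c \<otimes> inv x) = c" by (simp add: xc m_assoc flip: m_assoc[of x c])
    then show "c \<otimes> inv x = inv x \<otimes> c" by (simp add: inv_solve_left)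
  qed simp_all
  also have "\<dots> = A 0 k (- k)" by (simp add: A_def int_pow_neg int_pow_inv)
  finally have 2: "c [^] k \<otimes> b = b \<otimes> A 0 k (- k)" .
  have 3: "x [^] l \<otimes> b = b \<otimes> A 0 0 l"
    using int_pow_semiconj[OF _ _ _ xb] by (simp add: A_def)
  have "A i k l \<otimes> b = a [^] i \<otimes> (c [^] k \<otimes> (x [^] l \<otimes> b))" by (simp add: A_def m_assoc)
  also have "\<dots> = a [^] i \<otimes> ((c [^] k \<otimes> b) \<otimes> A 0 0 l)" by (simp add: 3 m_assoc)
  also have "\<dots> = (a [^] i \<otimes> b) \<otimes> A 0 k (l - k)" by (simp add: 2 m_assoc A_mult)
  also have "\<dots> = b \<otimes> A i (k + i) (l - k)" by (simp add: 1 m_assoc A_mult add.commute)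
  finally show ?thesis .
qed

text \<open>On exponent vectors \<open>(i, k, l)\<close> conjugation by \<open>b\<close> is
  unipotent: \<open>a\<close> contributes to \<open>c\<close>, and \<open>c\<close> contributes to
  \<open>x\<close> with a minus sign. Its powers therefore have binomial entries, and
  \<open>j\<close> is natural so that \<open>(j choose 2)\<close> makes sense.\<close>

lemma A_b_pow:
  "A i k l \<otimes> b [^] int j = b [^] int j \<otimes> A i (k + i * int j) (l - k * int j - i * int (j choose 2))"
proof (induction j)
  case (Suc j)
  have b: "b [^] int (Suc j) = b [^] int j \<otimes> b" by (simp add: int_pow_int del: of_nat_Suc)
  then have "A i k l \<otimes> b [^] int (Suc j) = (A i k l \<otimes> b [^] int j) \<otimes> b" by (simp add: m_assoc)
  also have "\<dots> = b [^] int j \<otimes> (A i (k + i * int j) (l - k * int j - i * int (j choose 2)) \<otimes> b)"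
    by (simp only: Suc) (simp add: m_assoc)
  also have "\<dots> = (b [^] int j \<otimes> b) \<otimes> A i (k + i * int (Suc j)) (l - k * int (Suc j) - i * int (Suc j choose 2))"
    by (simp add: A_b m_assoc numeral_2_eq_2 algebra_simps)
  finally show ?case by (simp only: b)
qed (simp add: numeral_2_eq_2)

lemma E_mult:
  "E j i k l \<otimes> E (int j') i' k' l'
    = E (j + int j') (i + i') (k + k' + i * int j') (l + l' - k * int j' - i * int (j' choose 2))"
proof -
  have "E j i k l \<otimes> E (int j') i' k' l' = b [^] j \<otimes> ((A i k l \<otimes> b [^] int j') \<otimes> A i' k' l')"
    by (simp add: E_def m_assoc)
  also have "\<dots> = (b [^] j \<otimes> b [^] int j') \<otimes>
      A (i + i') (k + k' + i * int j') (l + l' - k * int j' - i * int (j' choose 2))"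
    by (simp add: A_b_pow A_mult m_assoc algebra_simps)
  finally show ?thesis by (simp add: E_def int_pow_mult)
qed

lemma E_mult_0: "E j i k l \<otimes> E 0 i' k' l' = E j (i + i') (k + k') (l + l')"
  using E_mult[of j i k l 0] by (simp add: numeral_2_eq_2)

lemma E_mult_1: "E j i k l \<otimes> E 1 i' k' l' = E (j + 1) (i + i') (k + k' + i) (l + l' - k)"
  using E_mult[of j i k l 1] by (simp add: numeral_2_eq_2)

lemma E_cong:
  assumes "(int p)\<^sup>2 dvd k - k'" "int p dvd l - l'"
  shows "E j i k l = E j i k' l'"
proof -
  obtain r s where k: "k = k' + (int p)\<^sup>2 * r" and l: "l = l' + int p * s"
    using assms by (metis add.commute diff_eq_eq dvdE)
  have "c [^] k = c [^] k'" "x [^] l = x [^] l'"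
    by (simp_all add: k l int_pow_mult int_pow_pow[symmetric] c_pow x_pow)
  then show ?thesis by (simp add: E_def A_def)
qed

text \<open>Adding up the unipotent action over all factors raises each binomial coefficient by one,
  hence \<open>(s choose 3)\<close>.\<close>

lemma E_pow_b:
  "E 1 i k l [^] (s::nat) = E (int s) (i * int s) (k * int s + i * int (s choose 2))
     (l * int s - k * int (s choose 2) - i * int (s choose 3))"
proof (induction s)
  case 0
  show ?case by (simp add: E_gens numeral_2_eq_2 numeral_3_eq_3)
next
  case (Suc s)
  show ?case by (simp add: Suc E_mult_1) (simp add: numeral_3_eq_3 numeral_2_eq_2 algebra_simps)
qed

lemma E_pow: "\<exists>k' l'. E (int j) i k l [^] (s::nat) = E (int (j * s)) (i * int s) k' l'"
proof (induction s)
  case 0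
  show ?case by (auto simp: E_gens(5)[symmetric])
next
  case (Suc s)
  then obtain k' l' where "E (int j) i k l [^] s = E (int (j * s)) (i * int s) k' l'" by blast
  then have "E (int j) i k l [^] Suc s = E (int (j * s) + int j) (i * int s + i)
      (k' + k + i * int s * int j) (l' + l - k' * int j - i * int s * int (j choose 2))"
    by (simp only: nat_pow_Suc E_mult)
  then show ?case by (auto simp: algebra_simps)
qed

text \<open>Oddness of \<open>p\<close> lets the factor 2 be cancelled from
  \<open>p j (p j - 1)\<close>.\<close>

lemma p_dvd_choose_2: "int p dvd int (p * j choose 2)"
proof -
  have "2 * (p * j choose 2) = p * j * (p * j - 1)"
    using times_binomial_minus1_eq[of 2 "p * j"] by simp
  then have "p dvd 2 * (p * j choose 2)" by simp
  moreover have "coprime p 2" using odd_p by simp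
  ultimately have "p dvd (p * j choose 2)" by (simp add: coprime_dvd_mult_right_iff)
  then show ?thesis by (simp only: int_dvd_int_iff)
qed

text \<open>Elements whose \<open>b\<close>-exponent is divisible by \<open>p\<close> commute with
  \<open>c\<close>. All corrections to \<open>x\<close> then vanish, and the correction to
  \<open>c\<close> is a multiple of \<open>p\<close>, as in class 2.\<close>

lemma E_pow_C:
  "E (int (p * j)) i k l [^] (s::nat)
    = E (int (p * j * s)) (i * int s) (k * int s + int p * i * int j * int (s choose 2)) (l * int s)"
proof (induction s)
  case 0
  show ?case by (simp add: E_gens numeral_2_eq_2)
next
  case (Suc s)
  have dv: "int p dvd int (p * j choose 2)" by (rule p_dvd_choose_2)
  let ?K = "k * int s + int p * i * int j * int (s choose 2)"
  have "E (int (p * j)) i k l [^] Suc s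
      = E (int (p * j * s) + int (p * j)) (i * int s + i) (?K + k + i * int s * int (p * j))
          (l * int s + l - ?K * int (p * j) - i * int s * int (p * j choose 2))"
    by (simp only: nat_pow_Suc Suc E_mult)
  also have "\<dots> = E (int (p * j * s) + int (p * j)) (i * int s + i) (?K + k + i * int s * int (p * j))
          (l * int s + l)"
    using dv by (intro E_cong) auto
  also have "\<dots> = E (int (p * j * Suc s)) (i * int (Suc s))
      (k * int (Suc s) + int p * i * int j * int (Suc s choose 2)) (l * int (Suc s))"
    by (simp add: numeral_2_eq_2 algebra_simps)
  finally show ?case .
qed

text \<open>Natural \<open>b\<close>-exponents suffice in a finite group, and they make
  \<open>E_mult\<close> applicable to any two members.\<close>

definition T :: "'a set" where
  "T = {E (int j) i k l | j i k l. True}"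

lemma subgroup_T: "subgroup T G"
  using fin by (intro finite_closed_subgroup)
    (auto simp: T_def E_mult simp flip: of_nat_add, blast+)

lemma gens_in_T: "a \<in> T" "b \<in> T" "c \<in> T" "x \<in> T" "E 0 0 k l \<in> T"
proof -
  have "E (int j) i k l \<in> T" for j i k l by (auto simp: T_def)
  then show "a \<in> T" "b \<in> T" "c \<in> T" "x \<in> T" "E 0 0 k l \<in> T" for k l
    using E_gens by (metis of_nat_0 of_nat_1)+
qed

lemma E_comm_c: "c \<otimes> E (int j) i k l = E (int j) i k l \<otimes> (c \<otimes> x [^] (- int j))"
  using E_mult[of 0 0 1 0 j i k l] E_mult_0[of "int j" i k l 0 1 "- int j"]
  by (simp add: E_simps A_def add.commute)

end

section \<open>Carrying in the coordinates and the upper bound for the order\<close>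

locale class3_powers = class3_relations +
  fixes n m :: nat and w11 w12 w21 w22 :: int
  assumes m_ge: "m \<ge> 2" and n_ge: "n \<ge> m"
    and carrier_T: "carrier G = T"
    and a_pow: "a [^] (int p ^ n) = c [^] (w11 * int p) \<otimes> x [^] w12"
    and b_pow: "b [^] (int p ^ m) = c [^] (w21 * int p) \<otimes> x [^] w22"
begin

lemma obtain_E:
  assumes "g \<in> carrier G"
  obtains j i k l where "g = E (int j) i k l"
  using assms unfolding carrier_T T_def by blast

text \<open>The carry rule: full periods of the \<open>b\<close>- and \<open>a\<close>-exponents
  become exponents of \<open>c^p\<close> and \<open>x\<close>, weighted by the second and the first
  row of the characteristic matrix.\<close>

lemma E_shift:
  "E (j + int p ^ m * r) (i + int p ^ n * q) k l
    = E j i (k + w21 * int p * r + w11 * int p * q) (l + w22 * r + w12 * q)"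
proof -
  have cx': "(c [^] u \<otimes> x [^] v) [^] q = A 0 (u * q) (v * q)" for u v q :: int
    by (subst int_pow_mult_distrib) (simp_all add: int_pow_pow A_def int_pow_commute xc)
  have 1: "b [^] (int p ^ m * r) = A 0 (w21 * int p * r) (w22 * r)"
    using cx'[of "w21 * int p" w22 r] by (simp only: int_pow_pow[symmetric] b_pow cb)
  have 2: "a [^] (int p ^ n * q) = A 0 (w11 * int p * q) (w12 * q)"
    using cx'[of "w11 * int p" w12 q] by (simp only: int_pow_pow[symmetric] a_pow ca)
  have "A (i + int p ^ n * q) k l = A i 0 0 \<otimes> (a [^] (int p ^ n * q) \<otimes> A 0 k l)"
    by (simp add: A_def int_pow_mult m_assoc)
  also have "\<dots> = A i (k + w11 * int p * q) (l + w12 * q)"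
    unfolding 2 A_mult by (simp add: algebra_simps)
  finally have "E (j + int p ^ m * r) (i + int p ^ n * q) k l
      = b [^] j \<otimes> (b [^] (int p ^ m * r) \<otimes> A i (k + w11 * int p * q) (l + w12 * q))"
    by (simp add: E_def int_pow_mult m_assoc)
  then show ?thesis unfolding 1 A_mult by (simp add: E_def algebra_simps)
qed

definition box :: "(int \<times> int \<times> int \<times> int) set" where
  "box = {0..<int p ^ m} \<times> {0..<int p ^ n} \<times> {0..<(int p)\<^sup>2} \<times> {0..<int p}"

text \<open>Carries change the \<open>c\<close>-exponent by multiples of \<open>p\<close> and the
  \<open>x\<close>-exponent arbitrarily, so in general only \<open>k\<close> modulo \<open>p\<close>
  survives. The last clause records the case without carries.\<close>

lemma E_box:
  obtains k' l' where
    "E j i k l = E (j mod int p ^ m) (i mod int p ^ n) k' l'" "int p dvd k - k'"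
    "(j mod int p ^ m, i mod int p ^ n, k', l') \<in> box"
    "j = 0 \<Longrightarrow> i = 0 \<Longrightarrow> k' = k mod (int p)\<^sup>2 \<and> l' = l mod int p"
proof -
  let ?r = "j div int p ^ m" and ?q = "i div int p ^ n"
  define K where "K = k + w21 * int p * ?r + w11 * int p * ?q"
  define L where "L = l + w22 * ?r + w12 * ?q"
  have "E j i k l = E (j mod int p ^ m) (i mod int p ^ n) K L"
    using E_shift[of "j mod int p ^ m" ?r "i mod int p ^ n" ?q k l] by (simp add: K_def L_def)
  also have "\<dots> = E (j mod int p ^ m) (i mod int p ^ n) (K mod (int p)\<^sup>2) (L mod int p)"
    by (intro E_cong) (simp_all add: minus_mod_eq_mult_div)
  finally have eq: "E j i k l = E (j mod int p ^ m) (i mod int p ^ n) (K mod (int p)\<^sup>2) (L mod int p)" .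
  have "k - K mod (int p)\<^sup>2 = (K - K mod (int p)\<^sup>2) - int p * (w21 * ?r + w11 * ?q)"
    by (simp add: K_def algebra_simps)
  also have "K - K mod (int p)\<^sup>2 = int p * (int p * (K div (int p)\<^sup>2))"
    by (simp add: minus_mod_eq_mult_div power2_eq_square mult.assoc)
  finally have dv: "int p dvd k - K mod (int p)\<^sup>2" by simp
  have p0: "int p > 0" using p_gt_1 by simp
  have "(j mod int p ^ m, i mod int p ^ n, K mod (int p)\<^sup>2, L mod int p) \<in> box"
    using p0 by (auto simp: box_def)
  moreover have "j = 0 \<Longrightarrow> i = 0 \<Longrightarrow> K = k \<and> L = l" by (simp add: K_def L_def)
  ultimately show ?thesis using that eq dv by blast
qed

lemma card_box: "card box = p ^ (n + m + 3)"
  by (simp add: box_def card_cartesian_product power_add power2_eq_square power3_eq_cube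
      nat_power_eq nat_mult_distrib)

lemma image_box: "(\<lambda>(j, i, k, l). E j i k l) ` box = carrier G"
proof
  show "carrier G \<subseteq> (\<lambda>(j, i, k, l). E j i k l) ` box"
  proof
    fix g assume "g \<in> carrier G"
    then obtain j i k l where "g = E (int j) i k l" by (rule obtain_E)
    moreover obtain k' l' where "E (int j) i k l = E (int j mod int p ^ m) (i mod int p ^ n) k' l'"
      "(int j mod int p ^ m, i mod int p ^ n, k', l') \<in> box"
      using E_box[of "int j" i k l] by blast
    ultimately show "g \<in> (\<lambda>(j, i, k, l). E j i k l) ` box" by force
  qed
qed auto

lemma order_le: "order G \<le> p ^ (n + m + 3)"
  unfolding order_def image_box[symmetric] card_box[symmetric]
  by (rule card_image_le) (simp add: box_def)

end

section \<open>Uniqueness of the coordinates\<close>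

locale class3_group = class3_powers +
  assumes e_eq: "e = n + m + 3"
begin

text \<open>The exact order enters here: a surjection between finite sets of equal size is
  injective.\<close>

lemma inj_box: "inj_on (\<lambda>(j, i, k, l). E j i k l) box"
proof (rule eq_card_imp_inj_on)
  show "finite box" by (simp add: box_def)
  show "card ((\<lambda>(j, i, k, l). E j i k l) ` box) = card box"
    using order_eq by (simp add: image_box card_box order_def e_eq)
qed

lemma E_eq_one:
  assumes "E j i k l = \<one>"
  shows "int p ^ m dvd j \<and> int p ^ n dvd i \<and> int p dvd k"
    and "j = 0 \<Longrightarrow> i = 0 \<Longrightarrow> (int p)\<^sup>2 dvd k \<and> int p dvd l"
proof -
  obtain k' l' where 1: "E j i k l = E (j mod int p ^ m) (i mod int p ^ n) k' l'" "int p dvd k - k'"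
    "(j mod int p ^ m, i mod int p ^ n, k', l') \<in> box"
    "j = 0 \<Longrightarrow> i = 0 \<Longrightarrow> k' = k mod (int p)\<^sup>2 \<and> l' = l mod int p"
    using E_box[of j i k l] by blast
  have "(0, 0, 0, 0) \<in> box" using p_gt_1 by (auto simp: box_def)
  then have "(j mod int p ^ m, i mod int p ^ n, k', l') = (0, 0, 0, 0)"
    using inj_onD[OF inj_box _ 1(3), of "(0, 0, 0, 0)"] 1(1) assms by (simp add: E_gens(5))
  then show "int p ^ m dvd j \<and> int p ^ n dvd i \<and> int p dvd k"
    and "j = 0 \<Longrightarrow> i = 0 \<Longrightarrow> (int p)\<^sup>2 dvd k \<and> int p dvd l"
    using 1(2,4) by auto
qed

text \<open>Multiplying by \<open>b^(-j')\<close> on the left and by an element of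
  \<open><a,c,x>\<close> on the right subtracts coordinates without any collection, which reduces
  the comparison to \<open>E_eq_one\<close>.\<close>

lemma E_eqD:
  assumes "E j i k l = E j' i' k' l'"
  shows "int p ^ m dvd j - j' \<and> int p ^ n dvd i - i' \<and> int p dvd k - k'"
    and "j = j' \<Longrightarrow> i = i' \<Longrightarrow> (int p)\<^sup>2 dvd k - k' \<and> int p dvd l - l'"
proof -
  have "E (j - j') (i - i') (k - k') (l - l') = b [^] (- j') \<otimes> (E j i k l \<otimes> E 0 (- i') (- k') (- l'))"
    by (simp add: E_mult_0) (simp add: E_def flip: m_assoc int_pow_mult)
  also have "\<dots> = b [^] (- j') \<otimes> E j' 0 0 0"
    by (simp add: assms E_mult_0)
  also have "\<dots> = \<one>" by (simp add: E_simps int_pow_mult[symmetric])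
  finally have "E (j - j') (i - i') (k - k') (l - l') = \<one>" .
  from E_eq_one[OF this]
  show "int p ^ m dvd j - j' \<and> int p ^ n dvd i - i' \<and> int p dvd k - k'"
    and "j = j' \<Longrightarrow> i = i' \<Longrightarrow> (int p)\<^sup>2 dvd k - k' \<and> int p dvd l - l'" by auto
qed

lemma prime_dvd_mult: "int p dvd u * v \<longleftrightarrow> int p dvd u \<or> int p dvd v"
  using prime_int by (rule prime_dvd_mult_iff)

lemma p_dvd_power_imp: "int p ^ m dvd u \<Longrightarrow> int p dvd u" "int p ^ n dvd u \<Longrightarrow> int p dvd u"
  using m_ge n_ge by (meson dvd_power dvd_trans le_trans numeral_le_iff order_less_le_trans pos2)+

lemma square_dvd_mult: "(int p)\<^sup>2 dvd int p * u \<longleftrightarrow> int p dvd u"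
  using p_gt_1 by (simp add: power2_eq_square)

lemma x_ne_one: "x \<noteq> \<one>"
  using E_eq_one(2)[of 0 0 0 1] prime_int by (auto simp: E_gens)

section \<open>Minimal non-abelian subgroups of the class 3 group\<close>

text \<open>If \<open>c\<close> were outside \<open>H\<close>, its powers would represent all
  cosets, so \<open>H\<close> would contain \<open>a c^(-s)\<close> and \<open>b c^(-s')\<close> for
  some \<open>s\<close>, \<open>s'\<close>. Their commutator is \<open>c x^s\<close>, whose
  commutator with the second element yields \<open>x\<close>; hence \<open>c\<close> lies in
  \<open>H\<close> after all.\<close>

lemma c_mem_of_small_index:
  assumes H: "subgroup H G" and ind: "subgroup_index G H \<le> p"
  shows "c \<in> H"
proof (rule ccontr)
  assume nc: "c \<notin> H"
  have ex: "\<exists>s. E j i (- s) 0 \<in> H" for j i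
  proof -
    obtain s h where sh: "h \<in> H" "E j i 0 0 = h \<otimes> c [^] (s::nat)"
      using small_index_cosets[OF H ind cc nc E_closed[of j i 0 0]] by blast
    have hc: "h \<in> carrier G" using sh H subgroup.subset by blast
    have "E j i (- int s) 0 = E j i 0 0 \<otimes> E 0 0 (- int s) 0" by (simp add: E_mult_0)
    also have "\<dots> = h \<otimes> (c [^] int s \<otimes> c [^] (- int s))" using hc by (simp add: sh int_pow_int E_simps m_assoc)
    also have "\<dots> = h" using hc by (simp flip: int_pow_mult)
    finally show ?thesis using sh(1) by auto
  qed
  obtain s where u: "E 0 1 (- s) 0 \<in> H" using ex by blast
  obtain s' where v: "E 1 0 (- s') 0 \<in> H" using ex by blast
  have "(E 1 0 (- s') 0 \<otimes> E 0 1 (- s) 0) \<otimes> E 0 0 1 s = E 0 1 (- s) 0 \<otimes> E 1 0 (- s') 0"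
    by (simp add: E_mult_0 E_mult_1 algebra_simps)
  then have y: "E 0 0 1 s \<in> H"
    using subgroup_mult_cancel[OF H subgroup.m_closed[OF H v u], of "E 0 0 1 s"]
      subgroup.m_closed[OF H u v] by simp
  have "(E 0 0 1 s \<otimes> E 1 0 (- s') 0) \<otimes> E 0 0 0 1 = E 1 0 (- s') 0 \<otimes> E 0 0 1 s"
    unfolding E_mult_0 E_mult_1 by (simp add: algebra_simps)
  then have "E 0 0 0 1 \<in> H"
    using subgroup_mult_cancel[OF H subgroup.m_closed[OF H y v] _ E_closed[of 0 0 0 1]]
      subgroup.m_closed[OF H v y] by metis
  then have "x [^] (- s) \<in> H" using subgroup_int_pow_closed[OF H] by (simp only: E_gens(4))
  then have "E 0 0 1 s \<otimes> E 0 0 0 (- s) \<in> H" using subgroup.m_closed[OF H y] by (simp only: E_simps(4))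
  then show False using nc by (simp add: E_mult_0 E_gens)
qed

lemma A1_subgroup_index_gt:
  assumes A1: "A1_subgroup p H G"
  shows "subgroup_index G H > p"
proof (rule ccontr)
  assume "\<not> subgroup_index G H > p"
  then have ind: "subgroup_index G H \<le> p" by simp
  have H: "subgroup H G" using A1 by (simp add: A1_subgroup_def)
  have Hc: "H \<subseteq> carrier G" using H subgroup.subset by blast
  have cH: "c \<in> H" using c_mem_of_small_index[OF H ind] .
  have aH: "E 0 (int p) 0 0 \<in> H" and bH: "E (int p) 0 0 0 \<in> H"
    using small_index_pow_p[OF H ind] by (simp_all add: E_simps)
  show False
  proof (cases "\<forall>j i k l. E (int j) i k l \<in> H \<longrightarrow> p dvd j")
    case True
    \<comment> \<open>Now \<open>H\<close> lies in \<open>C_G(G')\<close>, so powers of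
      \<open>b\<close> represent the cosets. Comparing \<open>b\<close>-exponents shows that
      \<open>a\<close> needs the trivial one, that is, \<open>a\<close> is in
      \<open>H\<close>.\<close>
    have "b \<notin> H" using True[rule_format, of 1 0 0 0] p_gt_1 by (auto simp: E_gens)
    then obtain s h where sh: "s < p" "h \<in> H" "h \<otimes> b [^] (s::nat) = a"
      using small_index_cosets[OF H ind cb _ ca] by metis
    have "h \<in> carrier G" using sh Hc by blast
    then obtain j i k l where h: "h = E (int j) i k l" by (rule obtain_E)
    have "E 0 1 0 0 = E (int j) i k l \<otimes> E (int s) 0 0 0"
      unfolding E_gens(2) E_simps(1) int_pow_int h[symmetric] sh(3) ..
    then have "int p ^ m dvd 0 - (int j + int s)"
      unfolding E_mult using E_eqD(1) by blast
    then have "int p dvd int j + int s" by (metis p_dvd_power_imp(1) diff_0 dvd_minus_iff)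
    moreover have "int p dvd int j" using True sh h by auto
    ultimately have "int p dvd int s" by (simp add: dvd_add_right_iff)
    then have "s = 0" using sh(1) by (auto dest: dvd_imp_le)
    then have aH: "E 0 1 0 0 \<in> H" using sh Hc by (auto simp: E_gens)
    have "E 0 1 0 0 \<otimes> E (int p) 0 0 0 \<noteq> E (int p) 0 0 0 \<otimes> E 0 1 0 0"
    proof
      assume "E 0 1 0 0 \<otimes> E (int p) 0 0 0 = E (int p) 0 0 0 \<otimes> E 0 1 0 0"
      then have "(int p)\<^sup>2 dvd int p * 1"
        unfolding E_mult E_mult_0 using E_eqD(2) by fastforce
      then show False using p_gt_1 by (simp only: square_dvd_mult) simp
    qed
    then have gen: "generate G {E 0 1 0 0, E (int p) 0 0 0} = H"
      using A1_subgroup_generate[OF A1] aH bH by blast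
    \<comment> \<open>A subgroup containing \<open>a\<close> and \<open>b^p\<close> but not
      \<open>c\<close>: since \<open>b\<close>-exponents are multiples of \<open>p\<close>, products
      change \<open>c\<close>-exponents by multiples of \<open>p\<close> only.\<close>
    define K where "K = {E (int (p * j)) i (int p * k) l | j i k l. True}"
    have KI: "E (int (p * j)) i (int p * k) l \<in> K" for j i k l unfolding K_def by blast
    have "subgroup K G"
    proof (rule finite_closed_subgroup[OF fin])
      fix u v assume "u \<in> K" "v \<in> K"
      then obtain j i k l j' i' k' l' where
        "u = E (int (p * j)) i (int p * k) l" "v = E (int (p * j')) i' (int p * k') l'"
        unfolding K_def by blast
      then have "u \<otimes> v = E (int (p * (j + j'))) (i + i') (int p * (k + k' + i * j'))
        (l + l' - int p * k * int (p * j') - i * int (p * j' choose 2))"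
        by (simp only: E_mult) (simp add: algebra_simps)
      then show "u \<otimes> v \<in> K" using KI by metis
    next
      show "K \<subseteq> carrier G" unfolding K_def by auto
      show "K \<noteq> {}" using KI by blast
    qed
    moreover have "E 0 1 0 0 \<in> K" using KI[of 0 1 0 0] by simp
    moreover have "E (int p) 0 0 0 \<in> K" using KI[of 1 0 0 0] by simp
    ultimately have "H \<subseteq> K"
      using generate_subgroup_incl[of "{E 0 1 0 0, E (int p) 0 0 0}" K] unfolding gen by blast
    then have "E 0 0 1 0 \<in> K" using cH by (auto simp: E_gens)
    then obtain j i k l where "E 0 0 1 0 = E (int (p * j)) i (int p * k) l"
      unfolding K_def by blast
    then have "int p dvd 1 - int p * k" using E_eqD(1) by blast
    then have "int p dvd (1 - int p * k) + int p * k" by (rule dvd_add) simp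
    then show False using p_gt_1 by simp
  next
    case False
    then obtain j i k l where gH: "E (int j) i k l \<in> H" and j: "\<not> p dvd j" by blast
    define g where "g = E (int j) i k l"
    define z where "z = x [^] (- int j)"
    have cg: "c \<otimes> g = g \<otimes> (c \<otimes> z)" unfolding g_def z_def by (rule E_comm_c)
    have z: "z = E 0 0 0 (- int j)" by (simp add: z_def E_simps)
    have "z \<noteq> \<one>" using E_eq_one(2)[of 0 0 0 "- int j"] j by (auto simp: z)
    have gc [simp]: "g \<in> carrier G" and zc [simp]: "z \<in> carrier G" by (simp_all add: g_def z_def)
    have "z [^] int p = (x [^] int p) [^] (- int j)"
      by (simp only: z_def int_pow_pow cx mult.commute)
    then have zp: "z [^] p = \<one>" unfolding x_pow by (simp add: int_pow_int)
    interpret cc: central_commutator_p G g c z p e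
    proof
      show "z \<otimes> g = g \<otimes> z"
        unfolding z g_def E_mult E_mult_0 by (simp add: add.commute)
      show "z \<otimes> c = c \<otimes> z" unfolding z_def by (rule int_pow_semiconj) (simp_all add: xc)
    qed (use cg zp in simp_all)
    have "c \<otimes> g \<noteq> g \<otimes> c" using cg \<open>z \<noteq> \<one>\<close> by simp
    then have "generate G {g, c} = H"
      using A1_subgroup_generate[OF A1, of g c] gH cH unfolding g_def by metis
    then obtain i' j' k' where w: "E 0 (int p) 0 0 = cc.word i' j' k'"
      using aH unfolding cc.generate_eq_words by blast
    \<comment> \<open>Inside \<open><g,c>\<close> commutation with \<open>g\<close> produces only
      powers of \<open>z\<close>, hence of \<open>x\<close>. But moving \<open>a^p\<close> past
      \<open>g\<close> produces \<open>c^(p j)\<close>, which is nontrivial because \<open>p\<close>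
      does not divide \<open>j\<close>.\<close>
    have "E 0 (int p) 0 0 \<otimes> g = (g \<otimes> E 0 (int p) 0 0) \<otimes> z [^] j'"
      unfolding w cc.word_simps(3)[symmetric]
      using cc.word_mult[of i' j' k' 1 0 0] cc.word_mult[of 1 0 0 i' j' k'] cc.word_mult[of "1 + i'" j' k' 0 0 j']
      by (simp add: cc.word_simps add.commute)
    also have "z [^] j' = E 0 0 0 (- int j * j')" by (simp add: z_def E_simps int_pow_pow)
    finally have "E (int j) (int p + i) (k + int p * int j) (l - int p * int (j choose 2))
        = E (int j) (i + int p) k (l - int j * j')"
      unfolding g_def E_mult E_mult_0 by simp
    then have "(int p)\<^sup>2 dvd k + int p * int j - k"
      by (rule E_eqD(2)[THEN conjunct1]) simp_all
    then show False using j by (simp add: square_dvd_mult)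
  qed
qed

lemma A1_subgroup_b_c:
  shows "A1_subgroup p (generate G {b, c}) G" and "card (generate G {b, c}) \<le> p ^ (m + 3)"
proof -
  have x: "(inv x) [^] (k::int) = x [^] (- k)" for k by (simp add: int_pow_inv int_pow_neg)
  have "inv x \<otimes> b = b \<otimes> inv x" "inv x \<otimes> c = c \<otimes> inv x"
    using int_pow_semiconj[OF _ _ _ xb, of "- 1"] int_pow_semiconj[OF _ _ _ xc, of "- 1"]
    by (simp_all add: int_pow_neg)
  moreover have "inv x [^] p = \<one>" using x_pow by (simp add: int_pow_int nat_pow_inv)
  ultimately interpret bc: central_commutator_p G b c "inv x" p e
    using bc by unfold_locales auto
  show "A1_subgroup p (generate G {b, c}) G"
    using x_ne_one by (intro bc.A1_subgroup_generate) simp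
  \<comment> \<open>The commutator \<open>[c,b]\<close> is \<open>inv x\<close>, which explains the
    sign of \<open>w22\<close>. The exponents \<open>p^m\<close>, \<open>p^2\<close> and
    \<open>p\<close> of \<open>b\<close>, \<open>c\<close> and \<open>inv x\<close> multiply to
    \<open>p ^ (m + 3)\<close>.\<close>
  have "card (generate G {b, c}) \<le> p ^ m * p\<^sup>2 * p"
    using p_gt_1 c_pow b_pow
    by (intro bc.card_generate_le[of _ _ 0 "w21 * int p" "- w22"]) (simp_all add: x)
  then show "card (generate G {b, c}) \<le> p ^ (m + 3)" by (simp add: power_add power2_eq_square power3_eq_cube)
qed

text \<open>Turns membership in the part of \<open>H\<close> inside \<open><c,x>\<close> into linear
  algebra on exponent vectors.\<close>

lemma subgroup_E0_combine:
  assumes "subgroup H G" "E 0 0 k l \<in> H" "E 0 0 k' l' \<in> H"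
  shows "E 0 0 (s * k + s' * k') (s * l + s' * l') \<in> H"
proof -
  have "E 0 0 k l [^] s = E 0 0 (s * k) (s * l)" for k l s :: int
    unfolding E_simps by (subst int_pow_mult_distrib) (simp_all add: int_pow_pow int_pow_commute xc mult.commute)
  then have "E 0 0 (s * k) (s * l) \<in> H" "E 0 0 (s' * k') (s' * l') \<in> H"
    using assms subgroup_int_pow_closed by metis+
  then have "E 0 0 (s * k) (s * l) \<otimes> E 0 0 (s' * k') (s' * l') \<in> H" by (rule subgroup.m_closed[OF assms(1)])
  then show ?thesis by (simp add: E_mult_0)
qed

lemma x_mem:
  assumes "subgroup H G" "E 0 0 0 l \<in> H" "\<not> int p dvd l"
  shows "x \<in> H"
  using subgroup_pow_unit[OF assms(1) cx _ assms(3)] assms(2) by (simp add: E_simps)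

lemma c_pow_mem:
  assumes "subgroup H G" "E 0 0 (int p * k) 0 \<in> H" "\<not> int p dvd k"
  shows "E 0 0 (int p) 0 \<in> H"
proof -
  have "E 0 0 (int p) 0 [^] k = E 0 0 (int p * k) 0" by (simp add: E_simps int_pow_pow)
  then show ?thesis using subgroup_pow_unit[OF assms(1) _ _ assms(3), of "E 0 0 (int p) 0"] assms(2) by simp
qed

lemma E_mult_C:
  "E J i k l \<otimes> E (int (p * j)) i' k' l' = E (J + int (p * j)) (i + i') (k + k' + i * int (p * j)) (l + l')"
proof -
  have "int p dvd int (p * j choose 2)" by (rule p_dvd_choose_2)
  then show ?thesis unfolding E_mult by (intro E_cong) auto
qed

text \<open>The hypothesis \<open>inj\<close> says that the \<open>p^3\<close> products
  \<open>g^i h^j\<close> lie in distinct cosets of \<open><c^p,x>\<close>, a subgroup of order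
  \<open>p^2\<close> contained in \<open>H\<close>.\<close>

lemma card_ge_p5:
  assumes H: "subgroup H G" and gH: "g \<in> H" and hH: "h \<in> H"
    and cp: "E 0 0 (int p) 0 \<in> H" and xH: "x \<in> H"
    and inj: "\<And>i i' j j' k l. i < p\<^sup>2 \<Longrightarrow> i' < p\<^sup>2 \<Longrightarrow> j < p \<Longrightarrow> j' < p \<Longrightarrow>
      g [^] (i::nat) \<otimes> h [^] (j::nat) = g [^] (i'::nat) \<otimes> h [^] (j'::nat) \<otimes> E 0 0 (int p * k) l \<Longrightarrow> i = i' \<and> j = j'"
  shows "card H \<ge> p ^ 5"
proof -
  have N: "E 0 0 (int p * k) l \<in> H" for k l
    using subgroup_E0_combine[OF H cp, of 0 1 k l] xH by (simp add: E_gens mult.commute)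
  have Hc: "H \<subseteq> carrier G" using H subgroup.subset by blast
  then have [simp]: "g \<in> carrier G" "h \<in> carrier G" using gH hH by auto
  let ?f = "\<lambda>(i::nat, j::nat, k, l). g [^] i \<otimes> h [^] j \<otimes> E 0 0 (int p * k) l"
  let ?D = "{..<p\<^sup>2} \<times> {..<p} \<times> {0..<int p} \<times> {0..<int p}"
  have "inj_on ?f ?D"
  proof (rule inj_onI)
    fix u v assume uv: "u \<in> ?D" "v \<in> ?D" "?f u = ?f v"
    obtain i j k l where u: "u = (i, j, k, l)" by (cases u)
    obtain i' j' k' l' where v: "v = (i', j', k', l')" by (cases v)
    have r: "i < p\<^sup>2" "i' < p\<^sup>2" "j < p" "j' < p" "k \<in> {0..<int p}" "k' \<in> {0..<int p}"
      "l \<in> {0..<int p}" "l' \<in> {0..<int p}"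
      and eq: "g [^] i \<otimes> h [^] j \<otimes> E 0 0 (int p * k) l = g [^] i' \<otimes> h [^] j' \<otimes> E 0 0 (int p * k') l'"
      using uv by (auto simp: u v)
    have "g [^] i \<otimes> h [^] j \<otimes> E 0 0 (int p * k) l \<otimes> E 0 0 (int p * (- k)) (- l) = g [^] i \<otimes> h [^] j"
      by (simp add: m_assoc E_mult_0 E_gens)
    then have "g [^] i \<otimes> h [^] j = g [^] i' \<otimes> h [^] j' \<otimes> E 0 0 (int p * (k' - k)) (l' - l)"
      unfolding eq by (simp add: m_assoc E_mult_0 algebra_simps)
    then have ij: "i = i' \<and> j = j'" by (rule inj[OF r(1-4)])
    then have "E 0 0 (int p * k) l = E 0 0 (int p * k') l'" using eq by simp
    then have "(int p)\<^sup>2 dvd int p * (k - k')" "int p dvd l - l'"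
      using E_eqD(2) by (auto simp: right_diff_distrib)
    then have "k mod int p = k' mod int p" "l mod int p = l' mod int p"
      by (simp_all add: square_dvd_mult mod_eq_dvd_iff)
    then show "u = v" using ij r by (simp add: u v)
  qed
  then have "card (?f ` ?D) = p ^ 5"
    by (simp add: card_image card_cartesian_product power2_eq_square eval_nat_numeral)
  moreover have "?f ` ?D \<subseteq> H"
    using gH hH N H by (auto intro!: subgroup.m_closed[OF H])
      (metis H int_pow_int subgroup_int_pow_closed)+
  moreover have "finite H" using Hc fin finite_subset by blast
  ultimately show ?thesis by (metis card_mono)
qed

section \<open>The case \<open>n = m = 2\<close>: orders of the minimal non-abelian
  subgroups\<close>

context
  assumes nm: "n = 2" "m = 2"
begin

lemma E_shift_square:
  "E (j + (int p)\<^sup>2 * r) (i + (int p)\<^sup>2 * q) k l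
    = E j i (k + int p * (w21 * r + w11 * q)) (l + (w22 * r + w12 * q))"
  using E_shift[of j r i q k l] by (simp add: nm algebra_simps)

lemma E_pow_C_p:
  "E (int (p * j)) i k l [^] p = E 0 (i * int p) (int p * (k + w21 * int j)) (w22 * int j)"
proof -
  have dv: "int p dvd int (p choose 2)" using p_dvd_choose_2[of 1] by simp
  have "E (int (p * j)) i k l [^] p
      = E (0 + (int p)\<^sup>2 * int j) (i * int p + (int p)\<^sup>2 * 0)
          (k * int p + int p * i * int j * int (p choose 2)) (l * int p)"
    unfolding E_pow_C by (simp add: power2_eq_square algebra_simps)
  also have "\<dots> = E 0 (i * int p) (int p * (k + w21 * int j) + int p * i * int j * int (p choose 2))
      (w22 * int j + l * int p)"
    unfolding E_shift_square by (simp add: algebra_simps)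
  also have "\<dots> = E 0 (i * int p) (int p * (k + w21 * int j)) (w22 * int j)"
    using dv by (intro E_cong) (auto simp: square_dvd_mult mult.assoc)
  finally show ?thesis .
qed

text \<open>Only the first row of the matrix survives: the \<open>b\<close>-exponent
  \<open>p j p^2\<close> carries \<open>p j\<close> times the second row, which is trivial since
  \<open><c^p,x>\<close> has exponent \<open>p\<close>.\<close>

lemma E_pow_C_square:
  "E (int (p * j)) i k l [^] p\<^sup>2 = E 0 0 (int p * (w11 * i)) (w12 * i)"
proof -
  have dv: "int p dvd int (p\<^sup>2 choose 2)" using p_dvd_choose_2[of p] by (simp add: power2_eq_square)
  have "E (int (p * j)) i k l [^] p\<^sup>2
      = E (0 + (int p)\<^sup>2 * (int p * int j)) (0 + (int p)\<^sup>2 * i)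
          (k * int (p\<^sup>2) + int p * i * int j * int (p\<^sup>2 choose 2)) (l * int (p\<^sup>2))"
    unfolding E_pow_C by (simp add: algebra_simps)
  also have "\<dots> = E 0 0 (int p * (w11 * i) + int p * (int p * (k + w21 * int j) + i * int j * int (p\<^sup>2 choose 2)))
      (w12 * i + int p * (l * int p + w22 * int j))"
    unfolding E_shift_square by (simp add: power2_eq_square algebra_simps)
  also have "\<dots> = E 0 0 (int p * (w11 * i)) (w12 * i)"
  proof (rule E_cong)
    have "int p dvd int p * (k + w21 * int j) + i * int j * int (p\<^sup>2 choose 2)" using dv by simp
    then show "(int p)\<^sup>2 dvd int p * (w11 * i) + int p * (int p * (k + w21 * int j) + i * int j * int (p\<^sup>2 choose 2)) - int p * (w11 * i)"
      by (simp only: add_diff_cancel_left' square_dvd_mult)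
  qed simp
  finally show ?thesis .
qed

lemma E_pow_b_square:
  "E 1 i k l [^] p\<^sup>2 = E 0 0 (int p * (w21 + w11 * i)) (w22 + w12 * i)"
proof -
  have "p\<^sup>2 dvd 2 * (p\<^sup>2 choose 2)"
    using times_binomial_minus1_eq[of 2 "p\<^sup>2"] by simp
  then have "p\<^sup>2 dvd (p\<^sup>2 choose 2)" using odd_p by (simp add: coprime_dvd_mult_right_iff)
  then have d2: "(int p)\<^sup>2 dvd int (p\<^sup>2 choose 2)" by (metis int_dvd_int_iff of_nat_power)
  then have d2': "int p dvd int (p\<^sup>2 choose 2)" by (meson dvd_power dvd_trans pos2)
  \<comment> \<open>Otherwise all of \<open>p^2\<close> would have to divide the factor 3 in
    \<open>3 (p^2 choose 3)\<close>. The argument includes \<open>p = 3\<close>.\<close>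
  have "p dvd (p\<^sup>2 choose 3)"
  proof (rule ccontr)
    assume "\<not> p dvd (p\<^sup>2 choose 3)"
    then have "coprime (p\<^sup>2) (p\<^sup>2 choose 3)" using prime_p by (simp add: prime_imp_coprime)
    moreover have "p\<^sup>2 dvd 3 * (p\<^sup>2 choose 3)"
      using times_binomial_minus1_eq[of 3 "p\<^sup>2"] by simp
    ultimately have "p\<^sup>2 dvd 3" by (simp add: coprime_dvd_mult_left_iff)
    then have "p\<^sup>2 \<le> 3" by (rule dvd_imp_le) simp
    moreover have "2 * 2 \<le> p * p" using p_gt_1 by (intro mult_le_mono) auto
    ultimately show False by (simp add: power2_eq_square)
  qed
  then have d3: "int p dvd int (p\<^sup>2 choose 3)" by (simp only: int_dvd_int_iff)
  let ?K = "k * (int p)\<^sup>2 + i * int (p\<^sup>2 choose 2)"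
  let ?L = "l * (int p)\<^sup>2 - k * int (p\<^sup>2 choose 2) - i * int (p\<^sup>2 choose 3)"
  have "E 1 i k l [^] p\<^sup>2 = E (0 + (int p)\<^sup>2 * 1) (0 + (int p)\<^sup>2 * i) ?K ?L"
    unfolding E_pow_b by (simp add: mult.commute)
  also have "\<dots> = E 0 0 (?K + int p * (w21 + w11 * i)) (?L + (w22 + w12 * i))"
    unfolding E_shift_square by simp
  also have "\<dots> = E 0 0 (int p * (w21 + w11 * i)) (w22 + w12 * i)"
  proof (rule E_cong)
    show "(int p)\<^sup>2 dvd ?K + int p * (w21 + w11 * i) - int p * (w21 + w11 * i)" using d2 by simp
    show "int p dvd ?L + (w22 + w12 * i) - (w22 + w12 * i)" using d2' d3 by (simp add: power2_eq_square)
  qed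
  finally show ?thesis .
qed

text \<open>The commutator of the two elements is \<open>c^(p d)\<close> with
  \<open>d = i j' - i' j\<close> prime to \<open>p\<close>, which gives \<open>c^p\<close>. The
  \<open>p^2\<close>-th power of the first gives \<open>x\<close> modulo \<open>c^p\<close> if
  \<open>w12\<close> is nonzero; otherwise the two \<open>p\<close>-th powers are combined so that
  \<open>a\<close> cancels, leaving \<open>x^(w22 d)\<close> modulo \<open>c^p\<close>.\<close>

lemma card_ge_centralizer_case:
  assumes H: "subgroup H G"
    and u: "E (int (p * j)) i k l \<in> H" and v: "E (int (p * j')) i' k' l' \<in> H"
    and d: "\<not> int p dvd i * int j' - i' * int j" and i: "\<not> int p dvd i"
    and w: "\<not> int p dvd w12 \<or> \<not> int p dvd w22"
  shows "card H \<ge> p ^ 5"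
proof -
  have "(E (int (p * j')) i' k' l' \<otimes> E (int (p * j)) i k l) \<otimes> E 0 0 (int p * (i * int j' - i' * int j)) 0
      = E (int (p * j)) i k l \<otimes> E (int (p * j')) i' k' l'"
    unfolding E_mult_C E_mult_0 by (simp add: algebra_simps)
  then have "E 0 0 (int p * (i * int j' - i' * int j)) 0 \<in> H"
    using subgroup_mult_cancel[OF H subgroup.m_closed[OF H v u] _ E_closed] subgroup.m_closed[OF H u v]
    by metis
  then have cp: "E 0 0 (int p) 0 \<in> H" using c_pow_mem[OF H _ d] by blast
  have pw: "y \<in> H \<Longrightarrow> y [^] (s::nat) \<in> H" for y s
    using subgroup_int_pow_closed[OF H, of y "int s"] by (simp add: int_pow_int)
  have x: "x \<in> H"
  proof (cases "int p dvd w12")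
    case False
    have "E 0 0 (int p * (w11 * i)) (w12 * i) \<in> H"
      using pw[OF u, of "p\<^sup>2"] by (simp only: E_pow_C_square)
    from subgroup_E0_combine[OF H this cp, of 1 "- (w11 * i)"]
    have "E 0 0 0 (w12 * i) \<in> H" by (simp add: algebra_simps)
    then show ?thesis using x_mem[OF H, of "w12 * i"] False i by (simp add: prime_dvd_mult)
  next
    case True
    have AH: "E 0 I K L \<in> H \<Longrightarrow> E 0 (I * s) (K * s) (L * s) \<in> H" for I K L and s :: int
    proof -
      assume "E 0 I K L \<in> H"
      moreover have "E 0 I K L [^] s = E 0 (I * s) (K * s) (L * s)"
      proof -
        have "(c [^] K \<otimes> x [^] L) [^] s = c [^] (K * s) \<otimes> x [^] (L * s)"
          by (subst int_pow_mult_distrib) (simp_all add: int_pow_pow int_pow_commute xc)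
        moreover have "a [^] I \<otimes> (c [^] K \<otimes> x [^] L) = (c [^] K \<otimes> x [^] L) \<otimes> a [^] I"
          using A_mult[of I 0 0 0 K L] A_mult[of 0 K L I 0 0] by (simp add: A_def)
        ultimately have "A I K L [^] s = A (I * s) (K * s) (L * s)"
          unfolding A_def by (subst int_pow_mult_distrib) (simp_all add: int_pow_pow)
        then show ?thesis by (simp add: E_def)
      qed
      ultimately show ?thesis using subgroup_int_pow_closed[OF H] by metis
    qed
    have 1: "E 0 (i * int p) (int p * (k + w21 * int j)) (w22 * int j) \<in> H"
      using pw[OF u, of p] by (simp only: E_pow_C_p)
    have 2: "E 0 (i' * int p) (int p * (k' + w21 * int j')) (w22 * int j') \<in> H"
      using pw[OF v, of p] by (simp only: E_pow_C_p)
    define K where "K = i * (k' + w21 * int j') - i' * (k + w21 * int j)"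
    have "E 0 (i * int p * - i') (int p * (k + w21 * int j) * - i') (w22 * int j * - i')
        \<otimes> E 0 (i' * int p * i) (int p * (k' + w21 * int j') * i) (w22 * int j' * i)
      = E 0 0 (int p * K) (w22 * (i * int j' - i' * int j))"
      unfolding E_mult_0 K_def by (simp add: algebra_simps)
    then have "E 0 0 (int p * K) (w22 * (i * int j' - i' * int j)) \<in> H"
      using subgroup.m_closed[OF H AH[OF 1, of "- i'"] AH[OF 2, of i]] by (simp only:)
    from subgroup_E0_combine[OF H this cp, of 1 "- K"]
    have "E 0 0 0 (w22 * (i * int j' - i' * int j)) \<in> H" by (simp add: algebra_simps)
    then show ?thesis using x_mem[OF H] w True d by (simp add: prime_dvd_mult)
  qed
  show ?thesis
  proof (rule card_ge_p5[OF H u v cp x])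
    fix s s' t t' :: nat and K L :: int
    assume r: "s < p\<^sup>2" "s' < p\<^sup>2" "t < p" "t' < p"
      and eq: "E (int (p * j)) i k l [^] s \<otimes> E (int (p * j')) i' k' l' [^] t
        = E (int (p * j)) i k l [^] s' \<otimes> E (int (p * j')) i' k' l' [^] t' \<otimes> E 0 0 (int p * K) L"
    have "\<exists>k'' l''. E (int (p * j)) i k l [^] s \<otimes> E (int (p * j')) i' k' l' [^] t
        = E (int (p * j * s) + int (p * j' * t)) (i * int s + i' * int t) k'' l''" for s t
      unfolding E_pow_C E_mult by blast
    then obtain k1 l1 k2 l2 where
      "E (int (p * j * s) + int (p * j' * t)) (i * int s + i' * int t) k1 l1
        = E (int (p * j * s') + int (p * j' * t')) (i * int s' + i' * int t') k2 l2 \<otimes> E 0 0 (int p * K) L"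
      using eq by metis
    then have "(int p)\<^sup>2 dvd (int (p * j * s) + int (p * j' * t)) - (int (p * j * s') + int (p * j' * t')) \<and>
       (int p)\<^sup>2 dvd (i * int s + i' * int t) - (i * int s' + i' * int t')"
      unfolding E_mult_0 using E_eqD(1) nm by fastforce
    moreover have "(int (p * j * s) + int (p * j' * t)) - (int (p * j * s') + int (p * j' * t'))
        = int p * (int j * (int s - int s') + int j' * (int t - int t'))"
      by (simp add: algebra_simps)
    moreover have "(i * int s + i' * int t) - (i * int s' + i' * int t')
        = i * (int s - int s') + i' * (int t - int t')"
      by (simp add: algebra_simps)
    ultimately have 1: "int p dvd int j * (int s - int s') + int j' * (int t - int t')"
      and 2: "(int p)\<^sup>2 dvd i * (int s - int s') + i' * (int t - int t')"
      by (simp_all only: square_dvd_mult)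
    have 3: "int p dvd i * (int s - int s') + i' * (int t - int t')"
      using 2 by (meson dvd_power dvd_trans pos2)
    \<comment> \<open>Eliminating \<open>s - s'\<close> between the two congruences modulo
      \<open>p\<close> settles \<open>t\<close>; the \<open>a\<close>-exponent, known modulo
      \<open>p^2\<close>, then settles \<open>s\<close>.\<close>
    have "(i * int j' - i' * int j) * (int t - int t')
        = i * (int j * (int s - int s') + int j' * (int t - int t'))
          - int j * (i * (int s - int s') + i' * (int t - int t'))"
      by (simp add: algebra_simps)
    also have "int p dvd \<dots>" using 1 3 by (simp add: dvd_diff)
    finally have "int p dvd int t - int t'" using d by (simp add: prime_dvd_mult)
    then have "int t mod int p = int t' mod int p" by (simp add: mod_eq_dvd_iff)
    then have t: "t = t'" using r by simp
    then have "(int p)\<^sup>2 dvd i * (int s - int s')" using 2 by simp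
    moreover have "coprime ((int p)\<^sup>2) i" using coprime_prime_power[OF i, of 2] by (subst coprime_commute)
    ultimately have "(int p)\<^sup>2 dvd int s - int s'" by (simp add: coprime_dvd_mult_right_iff)
    then have "int s mod int (p\<^sup>2) = int s' mod int (p\<^sup>2)" by (simp add: mod_eq_dvd_iff)
    then show "s = s' \<and> t = t'" using r t by (simp flip: of_nat_power)
  qed
qed

lemma c_pow_x_mem:
  assumes H: "subgroup H G" and ne: "\<not> (int p dvd r \<and> int p dvd t)"
    and z: "E 0 0 (int p * r) (- t) \<in> H"
    and hp: "E 0 0 (int p * (w11 * r + t)) (w12 * r) \<in> H"
    and gp: "E 0 0 (int p * (w21 + w11 * i)) (w22 + w12 * i) \<in> H"
    and w: "(int p dvd w11 \<and> int p dvd w12 \<and> \<not> int p dvd w22) \<or> \<not> QuadRes (int p) (w11\<^sup>2 - 4 * w12)"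
  shows "E 0 0 (int p) 0 \<in> H \<and> x \<in> H"
proof -
  let ?D = "t\<^sup>2 + w11 * r * t + w12 * r\<^sup>2"
  show ?thesis
  proof (cases "int p dvd ?D")
    case False
    \<comment> \<open>The coefficients here and in the next step are the entries of the adjugate
      matrix of the first two vectors; they produce the determinant times each basis vector.\<close>
    have "E 0 0 (int p * ?D) 0 \<in> H"
      using subgroup_E0_combine[OF H z hp, of "w12 * r" t] by (simp add: power2_eq_square algebra_simps)
    moreover have "E 0 0 0 ?D \<in> H"
      using subgroup_E0_combine[OF H z hp, of "- (w11 * r + t)" r] by (simp add: power2_eq_square algebra_simps)
    ultimately show ?thesis using c_pow_mem[OF H _ False] x_mem[OF H _ False] by blast
  next
    case True
    have i: "(int p dvd w11 \<and> int p dvd w12 \<and> \<not> int p dvd w22)"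
    proof (rule ccontr)
      assume "\<not> ?thesis"
      then have nq: "\<not> QuadRes (int p) (w11\<^sup>2 - 4 * w12)" using w by blast
      show False
      proof (cases "int p dvd r")
        case True
        then have "int p dvd w11 * r * t + w12 * r\<^sup>2" by (simp add: power2_eq_square)
        then have "int p dvd t\<^sup>2" using \<open>int p dvd ?D\<close> by (simp add: add.assoc dvd_add_left_iff)
        then have "int p dvd t" using prime_int prime_dvd_power by blast
        then show False using True ne by blast
      next
        case False
        then have "coprime r (int p)" using coprime_prime_power[of r 1] by simp
        then obtain s where s: "[r * s = 1] (mod int p)" using cong_solve_coprime_int by blast
        \<comment> \<open>Completing the square: with \<open>s\<close> the inverse of
          \<open>r\<close>, the square of \<open>w11 + 2 t s\<close> is the discriminant plus
          \<open>4 s^2\<close> times the determinant. The factors 1 are written out so that the next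
          congruence can replace them by \<open>r * s\<close>.\<close>
        have "[(w11 + 2 * t * s)\<^sup>2 = (w11\<^sup>2 - 4 * w12) + 4 * (t\<^sup>2 * s\<^sup>2 + w11 * (1 * t * s) + w12 * 1\<^sup>2)] (mod int p)"
          by (simp add: power2_eq_square algebra_simps)
        also have "[(w11\<^sup>2 - 4 * w12) + 4 * (t\<^sup>2 * s\<^sup>2 + w11 * (1 * t * s) + w12 * 1\<^sup>2)
            = (w11\<^sup>2 - 4 * w12) + 4 * (t\<^sup>2 * s\<^sup>2 + w11 * ((r * s) * t * s) + w12 * (r * s)\<^sup>2)] (mod int p)"
          using cong_sym[OF s] by (intro cong_add cong_mult cong_pow cong_refl)
        also have "t\<^sup>2 * s\<^sup>2 + w11 * ((r * s) * t * s) + w12 * (r * s)\<^sup>2 = s\<^sup>2 * ?D"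
          by (simp add: power2_eq_square algebra_simps)
        also have "[(w11\<^sup>2 - 4 * w12) + 4 * (s\<^sup>2 * ?D) = (w11\<^sup>2 - 4 * w12) + 4 * (s\<^sup>2 * 0)] (mod int p)"
          using True by (intro cong_add cong_mult cong_refl) (simp add: cong_0_iff)
        finally show False using nq unfolding QuadRes_def by auto
      qed
    qed
    \<comment> \<open>Under (i) the determinant is \<open>t^2\<close> modulo \<open>p\<close>, so
      \<open>t\<close> vanishes and \<open>r\<close> does not. The first vector becomes a multiple
      of \<open>c^p\<close>, and the \<open>p^2\<close>-th power of \<open>g\<close> contributes
      \<open>x^w22\<close>.\<close>
    then have "int p dvd w11 * r * t + w12 * r\<^sup>2" by simp
    then have "int p dvd t\<^sup>2" using True by (simp add: add.assoc dvd_add_left_iff)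
    then have t: "int p dvd t" using prime_int prime_dvd_power by blast
    then have r: "\<not> int p dvd r" using ne by blast
    have "E 0 0 (int p * r) (- t) = E 0 0 (int p * r) 0" using t by (intro E_cong) auto
    then have cp: "E 0 0 (int p) 0 \<in> H" using c_pow_mem[OF H _ r] z by simp
    have "E 0 0 0 (w22 + w12 * i) \<in> H"
      using subgroup_E0_combine[OF H gp cp, of 1 "- (w21 + w11 * i)"] by (simp add: algebra_simps)
    moreover have "\<not> int p dvd w22 + w12 * i" using i by (simp add: dvd_add_left_iff)
    ultimately show ?thesis using cp x_mem[OF H] by blast
  qed
qed

lemma card_ge_outside_case:
  assumes A1: "A1_subgroup p H G" and g: "E 1 i k l \<in> H" and h: "E 0 R t u \<in> H"
    and nc: "E 0 R t u \<otimes> E 1 i k l \<noteq> E 1 i k l \<otimes> E 0 R t u"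
    and w: "(int p dvd w11 \<and> int p dvd w12 \<and> \<not> int p dvd w22) \<or> \<not> QuadRes (int p) (w11\<^sup>2 - 4 * w12)"
  shows "card H \<ge> p ^ 5"
proof -
  have H: "subgroup H G" using A1 by (simp add: A1_subgroup_def)
  have hg: "(E 1 i k l \<otimes> E 0 R t u) \<otimes> E 0 0 R (- t) = E 0 R t u \<otimes> E 1 i k l"
    unfolding E_mult_0 E_mult_1 by (simp add: algebra_simps)
  then have z: "E 0 0 R (- t) \<in> H"
    using subgroup_mult_cancel[OF H subgroup.m_closed[OF H g h] _ E_closed] subgroup.m_closed[OF H h g]
    by metis
  \<comment> \<open>If \<open>R\<close> were prime to \<open>p\<close>, then
    \<open>[h,g] = c^R x^(-t)\<close> would not commute with \<open>g\<close>, and minimality would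
    make \<open>H\<close> equal to \<open><[h,g], g>\<close>. There every \<open>a\<close>-exponent
    is \<open>i\<close> times the \<open>b\<close>-exponent modulo \<open>p\<close>, which
    \<open>h\<close> violates.\<close>
  have "int p dvd R"
  proof (rule ccontr)
    assume R: "\<not> int p dvd R"
    have "E 0 0 R (- t) \<otimes> E 1 i k l \<noteq> E 1 i k l \<otimes> E 0 0 R (- t)"
    proof
      assume "E 0 0 R (- t) \<otimes> E 1 i k l = E 1 i k l \<otimes> E 0 0 R (- t)"
      then have "E 1 i (R + k) (- t + l - R) = E 1 i (k + R) (l - t)"
        unfolding E_mult_0 E_mult_1 by simp
      then have "int p dvd (- t + l - R) - (l - t)" using E_eqD(2) by blast
      then show False using R by simp
    qed
    then have gen: "generate G {E 0 0 R (- t), E 1 i k l} = H"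
      using A1_subgroup_generate[OF A1 z g] by blast
    define K where "K = {E (int j) (i * int j) k' l' | j k' l'. True}"
    have KI: "E (int j) (i * int j) k' l' \<in> K" for j k' l' unfolding K_def by blast
    have "subgroup K G"
    proof (rule finite_closed_subgroup[OF fin])
      fix y y' assume "y \<in> K" "y' \<in> K"
      then obtain j k1 l1 j' k2 l2 where
        "y = E (int j) (i * int j) k1 l1" "y' = E (int j') (i * int j') k2 l2"
        unfolding K_def by blast
      then have "y \<otimes> y' = E (int (j + j')) (i * int (j + j')) (k1 + k2 + i * int j * int j')
          (l1 + l2 - k1 * int j' - i * int j * int (j' choose 2))"
        by (simp only: E_mult) (simp add: distrib_left)
      then show "y \<otimes> y' \<in> K" using KI by metis
    next
      show "K \<subseteq> carrier G" unfolding K_def by auto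
      show "K \<noteq> {}" using KI by blast
    qed
    moreover have "E 0 0 R (- t) \<in> K" using KI[of 0] by simp
    moreover have "E 1 i k l \<in> K" using KI[of 1] by simp
    ultimately have "H \<subseteq> K"
      using generate_subgroup_incl[of "{E 0 0 R (- t), E 1 i k l}" K] unfolding gen by blast
    then obtain j k' l' where "E 0 R t u = E (int j) (i * int j) k' l'" using h unfolding K_def by blast
    then have "int p ^ m dvd 0 - int j \<and> int p ^ n dvd R - i * int j" using E_eqD(1) by blast
    then have "int p dvd int j" "int p dvd R - i * int j"
      using p_dvd_power_imp(1)[of "0 - int j"] p_dvd_power_imp(2) by auto
    then have "int p dvd (R - i * int j) + i * int j" by (intro dvd_add) auto
    then show False using R by simp
  qed
  then obtain r where Rr: "R = int p * r" by blast
  have ne: "\<not> (int p dvd r \<and> int p dvd t)"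
  proof
    assume d: "int p dvd r \<and> int p dvd t"
    have "E 0 0 R (- t) = E 0 0 0 0"
      using d by (intro E_cong) (auto simp: Rr square_dvd_mult)
    then have "E 0 R t u \<otimes> E 1 i k l = E 1 i k l \<otimes> E 0 R t u"
      using hg by (simp add: E_mult_0)
    then show False using nc by blast
  qed
  have pw: "y \<in> H \<Longrightarrow> y [^] (s::nat) \<in> H" for y s
    using subgroup_int_pow_closed[OF H, of y "int s"] by (simp add: int_pow_int)
  have hpow: "E 0 R t u [^] (s::nat) = E 0 (R * int s) (t * int s) (u * int s)" for s
    using E_pow_C[of 0 R t u s] by simp
  have "E 0 R t u [^] p = E (0 + (int p)\<^sup>2 * 0) (0 + (int p)\<^sup>2 * r) (t * int p) (u * int p)"
    unfolding hpow by (simp add: Rr power2_eq_square algebra_simps)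
  also have "\<dots> = E 0 0 (int p * (w11 * r + t)) (w12 * r)"
    unfolding E_shift_square by (intro E_cong) (auto simp: algebra_simps)
  finally have hp: "E 0 0 (int p * (w11 * r + t)) (w12 * r) \<in> H" using pw[OF h, of p] by simp
  have gp: "E 0 0 (int p * (w21 + w11 * i)) (w22 + w12 * i) \<in> H"
    using pw[OF g, of "p\<^sup>2"] by (simp only: E_pow_b_square)
  have cpx: "E 0 0 (int p) 0 \<in> H" "x \<in> H"
    using c_pow_x_mem[OF H ne _ hp gp w] z by (simp_all add: Rr)
  show ?thesis
  proof (rule card_ge_p5[OF H g h cpx])
    fix s s' v v' :: nat and K L :: int
    assume r: "s < p\<^sup>2" "s' < p\<^sup>2" "v < p" "v' < p"
      and eq: "E 1 i k l [^] s \<otimes> E 0 R t u [^] v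
        = E 1 i k l [^] s' \<otimes> E 0 R t u [^] v' \<otimes> E 0 0 (int p * K) L"
    have "int p ^ m dvd int s - int s'"
      using eq unfolding hpow E_pow_b E_mult_0 using E_eqD(1) by blast
    then have "int s mod int (p\<^sup>2) = int s' mod int (p\<^sup>2)" by (simp add: nm mod_eq_dvd_iff)
    then have s: "s = s'" using r by (simp flip: of_nat_power)
    have "E 1 i k l [^] s \<otimes> E 0 R t u [^] v = E 1 i k l [^] s \<otimes> (E 0 R t u [^] v' \<otimes> E 0 0 (int p * K) L)"
      using eq by (simp add: s m_assoc)
    then have "E 0 R t u [^] v = E 0 R t u [^] v' \<otimes> E 0 0 (int p * K) L"
      by (subst (asm) Units_l_cancel) (auto simp: Units_eq)
    then have "int p ^ n dvd R * int v - R * int v'" "int p dvd t * int v - (t * int v' + int p * K)"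
      unfolding hpow E_mult_0 using E_eqD(1) by fastforce+
    moreover have "R * int v - R * int v' = int p * (r * (int v - int v'))"
      by (simp add: Rr algebra_simps)
    moreover have "(t * int v - (t * int v' + int p * K)) + int p * K = t * (int v - int v')"
      by (simp add: algebra_simps)
    ultimately have "int p dvd r * (int v - int v')" "int p dvd t * (int v - int v')"
      by (simp_all only: nm square_dvd_mult) (metis dvd_add dvd_triv_left)
    then have "int p dvd int v - int v'" using ne by (auto simp: prime_dvd_mult)
    then have "int v mod int p = int v' mod int p" by (simp add: mod_eq_dvd_iff)
    then show "s = s' \<and> v = v'" using r s by simp
  qed
qed

lemma A1_subgroup_card_ge:
  assumes A1: "A1_subgroup p H G"
    and w: "(int p dvd w11 \<and> int p dvd w12 \<and> \<not> int p dvd w22) \<or> \<not> QuadRes (int p) (w11\<^sup>2 - 4 * w12)"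
  shows "card H \<ge> p ^ 5"
proof -
  have H: "subgroup H G" using A1 by (simp add: A1_subgroup_def)
  have Hc: "H \<subseteq> carrier G" using H subgroup.subset by blast
  obtain u v where u: "u \<in> H" and v: "v \<in> H" and uv: "u \<otimes> v \<noteq> v \<otimes> u"
    using A1_subgroup_nonabelian[OF A1] by blast
  have uc: "u \<in> carrier G" and vc: "v \<in> carrier G" using u v Hc by auto
  \<comment> \<open>With \<open>w12 = 0\<close> the discriminant is the square \<open>w11^2\<close>,
    so only (i) remains, and it gives \<open>w22\<close> nonzero.\<close>
  have w': "\<not> int p dvd w12 \<or> \<not> int p dvd w22"
  proof (rule ccontr)
    assume "\<not> ?thesis"
    then have d: "int p dvd w12" and "\<not> QuadRes (int p) (w11\<^sup>2 - 4 * w12)" using w by auto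
    moreover have "[w11\<^sup>2 = w11\<^sup>2 - 4 * w12] (mod int p)"
      using d by (simp add: cong_iff_dvd_diff)
    ultimately show False unfolding QuadRes_def by blast
  qed
  obtain j i k l where ue: "u = E (int j) i k l" using uc by (rule obtain_E)
  obtain j' i' k' l' where ve: "v = E (int j') i' k' l'" using vc by (rule obtain_E)
  show ?thesis
  proof (cases "\<forall>j i k l. E (int j) i k l \<in> H \<longrightarrow> p dvd j")
    case True
    then have "p dvd j" "p dvd j'" using u v ue ve by blast+
    then obtain q q' where q: "j = p * q" "j' = p * q'" by blast
    define d where "d = i * int q' - i' * int q"
    have uvd: "u \<otimes> v = E (int j + int j') (i + i') (k + k' + i * int j') (l + l')"
      "v \<otimes> u = E (int j + int j') (i + i') (k + k' + i' * int j) (l + l')"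
      unfolding ue ve q E_mult_C by (simp_all add: algebra_simps)
    have "\<not> (int p)\<^sup>2 dvd (k + k' + i * int j') - (k + k' + i' * int j)"
    proof
      assume "(int p)\<^sup>2 dvd (k + k' + i * int j') - (k + k' + i' * int j)"
      then have "u \<otimes> v = v \<otimes> u" unfolding uvd by (intro E_cong) auto
      then show False using uv by blast
    qed
    moreover have "(k + k' + i * int j') - (k + k' + i' * int j) = int p * d"
      by (simp add: q d_def algebra_simps)
    ultimately have d: "\<not> int p dvd d" by (simp add: square_dvd_mult)
    \<comment> \<open>As \<open>d\<close> is prime to \<open>p\<close>, at least one of
      \<open>i\<close>, \<open>i'\<close> is too; exchanging \<open>u\<close> and \<open>v\<close>
      if necessary supplies the first element required by the centralizer case.\<close>
    show ?thesis
    proof (cases "int p dvd i")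
      case False
      then show ?thesis
        using card_ge_centralizer_case[OF H, of q i k l q' i' k' l'] u v d w' by (simp add: d_def ue ve q)
    next
      case True
      then have "\<not> int p dvd i'" using d by (auto simp: d_def)
      moreover have "\<not> int p dvd i' * int q - i * int q'"
        using d by (metis d_def dvd_minus_iff minus_diff_eq)
      ultimately show ?thesis
        using card_ge_centralizer_case[OF H, of q' i' k' l' q i k l] u v w' by (simp add: ue ve q)
    qed
  next
    case False
    then obtain j0 i0 k0 l0 where g0: "E (int j0) i0 k0 l0 \<in> H" and j0: "\<not> p dvd j0" by blast
    \<comment> \<open>Some element outside \<open>C_G(G')\<close> is not central in
      \<open>H\<close>. Otherwise \<open>v\<close> commutes with \<open>g\<close> and with
      \<open>g u\<close>, which also lies outside because \<open>u\<close> must lie inside; hence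
      \<open>v\<close> commutes with \<open>u\<close>.\<close>
    have "\<exists>j i k l h. E (int j) i k l \<in> H \<and> \<not> p dvd j \<and> h \<in> H \<and> h \<otimes> E (int j) i k l \<noteq> E (int j) i k l \<otimes> h"
    proof (rule ccontr)
      assume contr: "\<not> ?thesis"
      have com: "h \<otimes> E (int j) i k l = E (int j) i k l \<otimes> h"
        if "E (int j) i k l \<in> H" "\<not> p dvd j" "h \<in> H" for j i k l h
        using contr that by blast
      define g where "g = E (int j0) i0 k0 l0"
      have gc [simp]: "g \<in> carrier G" by (simp add: g_def)
      have gv: "v \<otimes> g = g \<otimes> v"
        using com[OF g0 j0] v by (simp_all add: g_def)
      have "p dvd j" using com[of j i k l v] u v uv by (auto simp: ue)
      then have "\<not> p dvd j0 + j" using j0 by (simp add: dvd_add_left_iff)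
      moreover have "\<exists>i k l. g \<otimes> u = E (int (j0 + j)) i k l"
        unfolding g_def ue E_mult of_nat_add by blast
      moreover have "g \<otimes> u \<in> H" using subgroup.m_closed[OF H g0 u] by (simp add: g_def)
      ultimately have "v \<otimes> (g \<otimes> u) = (g \<otimes> u) \<otimes> v" using com v by metis
      then have "g \<otimes> (v \<otimes> u) = g \<otimes> (u \<otimes> v)"
        using gv uc vc by (simp flip: m_assoc)
      then show False using uc vc uv by (subst (asm) Units_l_cancel) (auto simp: Units_eq)
    qed
    then obtain j i k l h where gH: "E (int j) i k l \<in> H" and j: "\<not> p dvd j" and h: "h \<in> H"
      and nc: "h \<otimes> E (int j) i k l \<noteq> E (int j) i k l \<otimes> h" by blast
    have hc: "h \<in> carrier G" using h Hc by blast
    have cent: "subgroup {y \<in> carrier G. h' \<otimes> y = y \<otimes> h'} G" if "h' \<in> carrier G" for h'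
    proof (rule finite_closed_subgroup[OF fin])
      fix y y' assume "y \<in> {y \<in> carrier G. h' \<otimes> y = y \<otimes> h'}" "y' \<in> {y \<in> carrier G. h' \<otimes> y = y \<otimes> h'}"
      then have y: "y \<in> carrier G" "y' \<in> carrier G" "h' \<otimes> y = y \<otimes> h'" "h' \<otimes> y' = y' \<otimes> h'" by auto
      have "h' \<otimes> (y \<otimes> y') = y \<otimes> y' \<otimes> h'" using y that by (metis m_assoc)
      then show "y \<otimes> y' \<in> {y \<in> carrier G. h' \<otimes> y = y \<otimes> h'}" using y by simp
    next
      show "{y \<in> carrier G. h' \<otimes> y = y \<otimes> h'} \<noteq> {}" using that by (auto intro!: exI[of _ \<one>])
    qed auto
    have pw: "y \<in> H \<Longrightarrow> y [^] (s::nat) \<in> H" for y s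
      using subgroup_int_pow_closed[OF H, of y "int s"] by (simp add: int_pow_int)
    have "coprime (p\<^sup>2) j" using prime_imp_coprime[OF prime_p j] by simp
    then have cop: "coprime j (p\<^sup>2)" by (rule coprime_commute[THEN iffD1])
    have "p\<^sup>2 \<noteq> 1" using p_gt_1 by simp
    \<comment> \<open>An inverse of \<open>j\<close> modulo \<open>p^2\<close>: the
      \<open>s\<close>-th power has \<open>b\<close>-exponent 1 after a carry. It still fails to
      commute with \<open>h\<close>, because \<open>s\<close> is prime to \<open>p\<close>.\<close>
    then obtain s where "[j * s = 1] (mod p\<^sup>2)" using cong_solve_coprime_nat[OF cop] by auto
    then have s: "int j * int s mod (int p)\<^sup>2 = 1 mod (int p)\<^sup>2"
      by (metis cong_def cong_int_iff of_nat_1 of_nat_mult of_nat_power)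
    then obtain q where q: "int (j * s) = 1 + (int p)\<^sup>2 * q"
      by (metis cong_def cong_iff_lin cong_sym of_nat_mult)
    obtain k1 l1 where "E (int j) i k l [^] s = E (int (j * s)) (i * int s) k1 l1"
      using E_pow by blast
    also have "\<dots> = E (1 + (int p)\<^sup>2 * q) (i * int s + (int p)\<^sup>2 * 0) k1 l1" by (simp add: q del: of_nat_mult)
    finally obtain I K L where gs: "E (int j) i k l [^] s = E 1 I K L"
      unfolding E_shift_square by blast
    then have g1: "E 1 I K L \<in> H" using pw[OF gH, of s] by simp
    have ps: "\<not> int p dvd int s"
    proof
      assume "int p dvd int s"
      then have "int p dvd int (j * s) - (int p)\<^sup>2 * q" by (simp add: power2_eq_square)
      then show False using q p_gt_1 by simp
    qed
    have nc1: "h \<otimes> E 1 I K L \<noteq> E 1 I K L \<otimes> h"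
    proof
      assume "h \<otimes> E 1 I K L = E 1 I K L \<otimes> h"
      then have "E (int j) i k l [^] int s \<in> {y \<in> carrier G. h \<otimes> y = y \<otimes> h}"
        by (simp add: int_pow_int gs)
      then have "E (int j) i k l \<in> {y \<in> carrier G. h \<otimes> y = y \<otimes> h}"
        by (rule subgroup_pow_unit[OF cent[OF hc] E_closed _ ps])
      then show False using nc by simp
    qed
    obtain j' i' k' l' where he: "h = E (int j') i' k' l'" using hc by (rule obtain_E)
    \<comment> \<open>A natural number congruent to \<open>- j'\<close> modulo \<open>p^2\<close>,
      so that \<open>h g^N\<close> has \<open>b\<close>-exponent 0 after a carry.\<close>
    define N where "N = j' * (p\<^sup>2 - 1)"
    have jN: "int j' + int N = 0 + (int p)\<^sup>2 * int j'"
      using p_gt_1 by (simp add: N_def of_nat_diff power2_eq_square algebra_simps)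
    have "\<exists>i2 k2 l2. h \<otimes> E 1 I K L [^] N = E (int j' + int N) i2 k2 l2"
      unfolding he E_pow_b E_mult by blast
    then obtain i2 k2 l2 where "h \<otimes> E 1 I K L [^] N = E (0 + (int p)\<^sup>2 * int j') (i2 + (int p)\<^sup>2 * 0) k2 l2"
      unfolding jN by auto
    then obtain R t u where h1: "h \<otimes> E 1 I K L [^] N = E 0 R t u"
      unfolding E_shift_square by blast
    have h1H: "E 0 R t u \<in> H" using subgroup.m_closed[OF H h pw[OF g1, of N]] by (simp add: h1)
    have "E 0 R t u \<otimes> E 1 I K L \<noteq> E 1 I K L \<otimes> E 0 R t u"
    proof
      let ?g = "E 1 I K L"
      assume "E 0 R t u \<otimes> ?g = ?g \<otimes> E 0 R t u"
      then have "(h \<otimes> ?g [^] N) \<otimes> ?g = ?g \<otimes> (h \<otimes> ?g [^] N)" by (simp add: h1)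
      moreover have "(h \<otimes> ?g [^] N) \<otimes> ?g = (h \<otimes> ?g) \<otimes> ?g [^] N"
        using hc by (simp only: m_assoc E_closed nat_pow_closed nat_pow_Suc2[symmetric] nat_pow_Suc[symmetric])
      ultimately have "(h \<otimes> ?g) \<otimes> ?g [^] N = (?g \<otimes> h) \<otimes> ?g [^] N" using hc by (simp add: m_assoc)
      then have "h \<otimes> ?g = ?g \<otimes> h" using hc by (subst (asm) right_cancel) auto
      then show False using nc1 by blast
    qed
    then show ?thesis using card_ge_outside_case[OF A1 g1 h1H _ w] by blast
  qed
qed

text \<open>All three vectors are made proportional, so that the generated subgroup meets
  \<open><c^p,x>\<close> only in the powers of \<open>z = [h,g]\<close>. Taking \<open>r = 2\<close>
  avoids division by 2: the determinant becomes \<open>t^2 + 2 w11 t + 4 w12\<close>, with roots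
  \<open>- w11 + y\<close> and \<open>- w11 - y\<close> for \<open>y\<close> a square root of the
  discriminant. The parameter \<open>i\<close> then aligns the third vector.\<close>

lemma ex_A1_subgroup_card_le:
  assumes qr: "QuadRes (int p) (w11\<^sup>2 - 4 * w12)"
    and ni: "\<not> (int p dvd w11 \<and> int p dvd w12 \<and> \<not> int p dvd w22)"
  obtains H where "A1_subgroup p H G" "card H \<le> p ^ 4"
proof -
  have p2: "\<not> int p dvd 2"
  proof
    assume "int p dvd 2"
    then have "p dvd 2" by (metis int_dvd_int_iff of_nat_numeral)
    then show False using p_gt_1 odd_p by (metis dvd_imp_le even_numeral le_antisym less_eq_Suc_le numeral_2_eq_2 one_add_one plus_1_eq_Suc pos2)
  qed
  have half: "int p dvd v" if "int p dvd 2 * v" for v using that p2 by (simp add: prime_dvd_mult)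
  obtain y where y: "int p dvd y\<^sup>2 - (w11\<^sup>2 - 4 * w12)"
    using qr unfolding QuadRes_def by (auto simp: cong_iff_dvd_diff)
  have root: "int p dvd t\<^sup>2 + 2 * w11 * t + 4 * w12" if "t = - w11 + y \<or> t = - w11 - y" for t
  proof -
    have "t\<^sup>2 + 2 * w11 * t + 4 * w12 = y\<^sup>2 - (w11\<^sup>2 - 4 * w12)"
      using that by (elim disjE; simp only:; simp add: power2_eq_square algebra_simps)
    then show ?thesis using y by (simp only:)
  qed
  have solve: "\<exists>i. int p dvd u + i * v" if "\<not> int p dvd v" for u v
  proof -
    have "coprime v (int p)" using coprime_prime_power[OF that, of 1] by simp
    then obtain s where "[v * s = 1] (mod int p)" using cong_solve_coprime_int by blast
    then have "int p dvd u * (1 - v * s)" by (metis cong_iff_dvd_diff cong_sym dvd_mult)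
    then have "int p dvd u + (- (u * s)) * v" by (simp add: algebra_simps)
    then show ?thesis by blast
  qed
  have "\<exists>t i. int p dvd t\<^sup>2 + 2 * w11 * t + 4 * w12 \<and>
      int p dvd (2 * w22 + t * w21) + i * (2 * w12 + t * w11)"
  \<comment> \<open>For a given root \<open>t\<close>, the equation for \<open>i\<close> is solvable
    unless its coefficient \<open>2 w12 + t w11\<close> vanishes. If that happens for both roots,
    then both are 0 and \<open>w11 = w12 = 0\<close>; failure of (i) gives \<open>w22 = 0\<close>,
    and any \<open>i\<close> works.\<close>
  proof (cases "int p dvd 2 * w12 + (- w11 + y) * w11 \<and> int p dvd 2 * w12 + (- w11 - y) * w11")
    case False
    then show ?thesis using root solve by blast
  next
    case True

    have sq: "int p dvd t" if "int p dvd t\<^sup>2 + 2 * w11 * t + 4 * w12" "int p dvd 2 * w12 + t * w11" for t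
    proof -
      have "t\<^sup>2 = (t\<^sup>2 + 2 * w11 * t + 4 * w12) - 2 * (2 * w12 + t * w11)" by simp
      then have "int p dvd t\<^sup>2" using that by (metis dvd_diff dvd_mult)
      then show ?thesis using prime_int prime_dvd_power by blast
    qed
    have t1: "int p dvd - w11 + y" and t2: "int p dvd - w11 - y" using sq root True by blast+
    have "int p dvd (- w11 + y) + (- w11 - y)" using t1 t2 by (rule dvd_add)
    then have w11: "int p dvd w11" using half[of "- w11"] by simp
    moreover have "int p dvd w12"
    proof -
      have "int p dvd (2 * w12 + (- w11 + y) * w11) - (- w11 + y) * w11"
        using True w11 by (intro dvd_diff) auto
      then show ?thesis using half[of w12] by simp
    qed
    ultimately have "int p dvd w22" using ni by blast
    then have "int p dvd (2 * w22 + (- w11 + y) * w21) + 0 * (2 * w12 + (- w11 + y) * w11)"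
      using t1 by simp
    then show ?thesis using root[of "- w11 + y"] by blast
  qed
  then obtain t i where t: "int p dvd t\<^sup>2 + 2 * w11 * t + 4 * w12"
    and i: "int p dvd (2 * w22 + t * w21) + i * (2 * w12 + t * w11)" by blast
  define g where "g = E 1 i 0 0"
  define h where "h = E 0 (2 * int p) t 0"
  define z where "z = E 0 0 (2 * int p) (- t)"
  have zpow: "z [^] (s::int) = E 0 0 (int p * (2 * s)) (- (t * s))" for s
    unfolding z_def E_simps by (subst int_pow_mult_distrib)
      (simp_all add: int_pow_pow int_pow_commute xc algebra_simps)
  have zp: "z [^] p = \<one>"
  proof -
    have "z [^] int p = E 0 0 0 0"
      unfolding zpow by (intro E_cong) (simp_all add: square_dvd_mult)
    then show ?thesis by (simp add: int_pow_int E_gens)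
  qed
  have "z \<noteq> \<one>"
    using E_eq_one(2)[of 0 0 "2 * int p" "- t"] p2 by (auto simp: z_def mult.commute[of 2] square_dvd_mult)
  interpret gh: central_commutator_p G g h z p e
  proof
    show "h \<otimes> g = g \<otimes> (h \<otimes> z)"
      unfolding g_def h_def z_def E_mult_0 E_mult_1 by (simp add: algebra_simps)
    have "E 1 i (2 * int p) (- t - 2 * int p) = E 1 i (2 * int p) (- t)" by (intro E_cong) auto
    then show "z \<otimes> g = g \<otimes> z"
      unfolding g_def z_def E_mult_0 E_mult_1 by simp
    show "z \<otimes> h = h \<otimes> z" unfolding h_def z_def E_mult_0 by (simp add: algebra_simps)
  qed (simp_all add: g_def h_def z_def zp[unfolded z_def])
  \<comment> \<open>The assumption says that \<open>(X, Y)\<close> is proportional to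
    \<open>(2, -t)\<close> modulo \<open>p\<close>, the vector of \<open>z\<close>. The number
    \<open>q\<close> is the inverse \<open>(p + 1) / 2\<close> of 2.\<close>
  have dep: "\<exists>s. E 0 0 (int p * X) Y = z [^] (s::int)" if "int p dvd 2 * Y + t * X" for X Y
  proof -
    obtain q where q: "int p + 1 = 2 * q" using odd_p by (metis even_plus_one_iff evenE even_of_nat)
    define s where "s = X * q"
    have "X - 2 * s = X * (1 - 2 * q)" by (simp add: s_def algebra_simps)
    also have "\<dots> = - (X * int p)" unfolding q[symmetric] by simp
    finally have X: "X - 2 * s = - (X * int p)" .
    have "2 * (Y + t * s) = (2 * Y + t * X) - t * (X - 2 * s)" by (simp add: algebra_simps)
    also have "int p dvd \<dots>" using that X by (intro dvd_diff) auto
    finally have "int p dvd Y + t * s" by (rule half)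
    moreover have "int p * X - int p * (2 * s) = int p * (X - 2 * s)" by (simp add: algebra_simps)
    ultimately have "E 0 0 (int p * X) Y = E 0 0 (int p * (2 * s)) (- (t * s))"
      using X by (intro E_cong) (simp_all only: square_dvd_mult, auto)
    then show ?thesis unfolding zpow by blast
  qed
  \<comment> \<open>Vanishing of the determinant at \<open>r = 2\<close> is exactly the condition
    that \<open>h^p\<close> be a power of \<open>z\<close>.\<close>
  have "int p dvd 2 * (w12 * 2) + t * (w11 * 2 + t)" using t by (simp add: power2_eq_square algebra_simps)
  then obtain s where s: "E 0 0 (int p * (w11 * 2 + t)) (w12 * 2) = z [^] (s::int)" using dep by blast
  have "h [^] p = E (0 + (int p)\<^sup>2 * 0) (0 + (int p)\<^sup>2 * 2) (t * int p) 0"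
    unfolding h_def using E_pow_C[of 0 "2 * int p" t 0 p] by (simp add: power2_eq_square algebra_simps)
  also have "\<dots> = z [^] s" unfolding E_shift_square s[symmetric] by (simp add: algebra_simps)
  finally have hL: "h [^] int p = z [^] s" by (simp add: int_pow_int)
  have "int p dvd 2 * (w22 + w12 * i) + t * (w21 + w11 * i)" using i by (simp add: algebra_simps)
  then obtain s' where s': "E 0 0 (int p * (w21 + w11 * i)) (w22 + w12 * i) = z [^] (s'::int)" using dep by blast
  have gM: "g [^] int (p\<^sup>2) = h [^] (0::int) \<otimes> z [^] s'"
    unfolding int_pow_int g_def E_pow_b_square s' by simp
  have "card (generate G {g, h}) \<le> p\<^sup>2 * p * p"
    using p_gt_1 by (intro gh.card_generate_le[OF _ _ hL gM]) auto
  then have "card (generate G {g, h}) \<le> p ^ 4" by (simp add: power2_eq_square power4_eq_xxxx)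
  then show ?thesis using that gh.A1_subgroup_generate[OF \<open>z \<noteq> \<one>\<close>] by blast
qed

end

text \<open>Translates orders into indices by means of \<open>order G = p ^ (n + m + 3)\<close>.
  \<open>QuadRes\<close> counts 0 as a residue, so a vanishing discriminant belongs to the side
  where a small subgroup exists unless (i) holds.\<close>

theorem I_min_I_max:
  shows "I_min p G \<ge> 2" and "\<not> (\<exists>H. A1_subgroup p H G \<and> subgroup_index G H = p)"
    and "I_max p G \<ge> n"
    and "I_max p G = 2 \<longleftrightarrow> n = 2 \<and> m = 2 \<and>
      ((int p dvd w11 \<and> int p dvd w12 \<and> \<not> int p dvd w22) \<or> \<not> QuadRes (int p) (w11\<^sup>2 - 4 * w12))"
proof -
  let ?I = "A1_indices p G"
  have p1: "1 < p" by (rule p_gt_1)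
  have idx: "subgroup_index G H * card H = p ^ (n + m + 3)" if "subgroup H G" for H
    using index_mult_card[OF that] by (simp add: order_eq e_eq)
  have A1H: "subgroup H G" if "A1_subgroup p H G" for H using that by (simp add: A1_subgroup_def)
  let ?H0 = "generate G {b, c}"
  have H0: "subgroup_index G ?H0 \<in> ?I" using A1_subgroup_b_c(1) by (auto simp: A1_indices_def)
  then have ne: "?I \<noteq> {}" by blast
  have "p ^ n * p ^ (m + 3) = subgroup_index G ?H0 * card ?H0"
    using idx[OF A1H[OF A1_subgroup_b_c(1)]] by (simp add: power_add)
  also have "\<dots> \<le> subgroup_index G ?H0 * p ^ (m + 3)" using A1_subgroup_b_c(2) by simp
  finally have "p ^ n \<le> subgroup_index G ?H0" using p1 by simp
  also have "\<dots> \<le> p ^ I_max p G"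
    unfolding I_max_eq[OF ne] using H0 A1_indices_finite by simp
  finally show max_ge: "I_max p G \<ge> n" using p1 by simp
  show "\<not> (\<exists>H. A1_subgroup p H G \<and> subgroup_index G H = p)"
    using A1_subgroup_index_gt by blast
  have "p ^ I_min p G \<in> ?I" unfolding I_min_eq[OF ne] using A1_indices_finite ne by simp
  then have "p ^ 1 < p ^ I_min p G" using A1_subgroup_index_gt by (auto simp: A1_indices_def)
  then show "I_min p G \<ge> 2" using p1 by (simp only: power_strict_increasing_iff)
  let ?W = "(int p dvd w11 \<and> int p dvd w12 \<and> \<not> int p dvd w22) \<or> \<not> QuadRes (int p) (w11\<^sup>2 - 4 * w12)"
  show "I_max p G = 2 \<longleftrightarrow> n = 2 \<and> m = 2 \<and> ?W"
  proof
    assume I2: "I_max p G = 2"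
    then have nm: "n = 2" "m = 2" using max_ge n_ge m_ge by auto
    moreover have ?W
    proof (rule ccontr)
      assume "\<not> ?W"
      then obtain H where H: "A1_subgroup p H G" "card H \<le> p ^ 4"
        using ex_A1_subgroup_card_le[OF nm] by blast
      have "p ^ 3 * p ^ 4 = subgroup_index G H * card H"
        using idx[OF A1H[OF H(1)]] by (simp add: nm flip: power_add)
      also have "\<dots> \<le> subgroup_index G H * p ^ 4" using H by simp
      finally have "p ^ 3 \<le> subgroup_index G H" by (rule mult_right_le_imp_le) (use p1 in simp)
      also have "\<dots> \<le> p ^ I_max p G"
        unfolding I_max_eq[OF ne] using H A1_indices_finite by (auto simp: A1_indices_def intro!: Max_ge)
      finally show False using p1 by (simp add: I2)
    qed
    ultimately show "n = 2 \<and> m = 2 \<and> ?W" by blast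
  next
    assume W: "n = 2 \<and> m = 2 \<and> ?W"
    have "p ^ I_max p G \<in> ?I" unfolding I_max_eq[OF ne] using A1_indices_finite ne by simp
    then obtain H where H: "A1_subgroup p H G" "p ^ I_max p G = subgroup_index G H"
      by (auto simp: A1_indices_def)
    have "p ^ I_max p G * p ^ 5 \<le> subgroup_index G H * card H"
      using A1_subgroup_card_ge[OF _ _ H(1)] W H(2) by simp
    also have "\<dots> = p ^ 2 * p ^ 5"
      using idx[OF A1H[OF H(1)]] W by (simp flip: power_add)
    finally have "p ^ I_max p G \<le> p ^ 2" by (rule mult_right_le_imp_le) (use p1 in simp)
    then have "I_max p G \<le> 2" using p1 by simp
    then show "I_max p G = 2" using max_ge W by simp
  qed
qed

end

section \<open>Relations from the type of the centralizer\<close>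

context group
begin

lemma commutator_closed [simp]:
  "h \<in> carrier G \<Longrightarrow> k \<in> carrier G \<Longrightarrow> commutator G h k \<in> carrier G"
  by (simp add: commutator_def)

lemma inv_mult_cancel: "g \<in> carrier G \<Longrightarrow> y \<in> carrier G \<Longrightarrow> inv g \<otimes> (g \<otimes> y) = y"
  "g \<in> carrier G \<Longrightarrow> y \<in> carrier G \<Longrightarrow> g \<otimes> (inv g \<otimes> y) = y"
  by (simp_all flip: m_assoc)

lemma commutator_swap:
  "h \<in> carrier G \<Longrightarrow> k \<in> carrier G \<Longrightarrow> h \<otimes> k = k \<otimes> (h \<otimes> commutator G h k)"
  by (simp add: commutator_def m_assoc inv_mult_cancel)

lemma commutator_eqI:
  assumes "h \<in> carrier G" "k \<in> carrier G" "u \<in> carrier G" "h \<otimes> k = k \<otimes> (h \<otimes> u)"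
  shows "commutator G h k = u"
proof -
  have "commutator G h k = inv h \<otimes> (inv k \<otimes> (h \<otimes> k))" using assms(1,2) by (simp add: commutator_def m_assoc)
  then show ?thesis using assms(1-3) by (simp add: assms(4) inv_mult_cancel)
qed

lemma commutator_conj:
  assumes "g \<in> carrier G" "h \<in> carrier G" "k \<in> carrier G"
  shows "g \<otimes> commutator G h k \<otimes> inv g = commutator G (g \<otimes> h \<otimes> inv g) (g \<otimes> k \<otimes> inv g)"
  using assms by (simp add: commutator_def inv_mult_group m_assoc inv_mult_cancel)

lemma commutator_eq_one_iff:
  "h \<in> carrier G \<Longrightarrow> k \<in> carrier G \<Longrightarrow> commutator G h k = \<one> \<longleftrightarrow> h \<otimes> k = k \<otimes> h"
  using commutator_swap[of h k] by (auto simp flip: m_assoc)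

lemma commutator_inverse:
  "h \<in> carrier G \<Longrightarrow> k \<in> carrier G \<Longrightarrow> inv (commutator G h k) = commutator G k h"
  by (simp add: commutator_def inv_mult_group m_assoc)

lemma commutator_in_derived:
  assumes "h \<in> carrier G" "k \<in> carrier G"
  shows "commutator G h k \<in> derived G (carrier G)"
proof -
  have "commutator G h k = inv h \<otimes> inv k \<otimes> inv (inv h) \<otimes> inv (inv k)"
    using assms by (simp add: commutator_def)
  moreover have "inv h \<otimes> inv k \<otimes> inv (inv h) \<otimes> inv (inv k) \<in> derived_set G (carrier G)"
    by (rule UN_I[of "inv h"], use assms in simp, rule UN_I[of "inv k"], use assms in simp, rule singletonI)
  ultimately have "commutator G h k \<in> derived_set G (carrier G)" by (simp only:)
  then show ?thesis unfolding derived_def by (rule generate.incl)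
qed

lemma normal_G3: "G3 G \<lhd> G"
  unfolding G3_def commutator_subgroup_def
proof (rule normal_generateI)
  have d: "derived G (carrier G) \<lhd> G" using derived_is_normal normal_self by blast
  have dc: "derived G (carrier G) \<subseteq> carrier G" by (simp add: derived_in_carrier)
  show "{commutator G h k | h k. h \<in> derived G (carrier G) \<and> k \<in> carrier G} \<subseteq> carrier G"
    using dc commutator_closed by blast
  fix y g assume "y \<in> {commutator G h k | h k. h \<in> derived G (carrier G) \<and> k \<in> carrier G}"
    and g: "g \<in> carrier G"
  then obtain h k where y: "y = commutator G h k" and h: "h \<in> derived G (carrier G)" and k: "k \<in> carrier G"
    by blast
  have "g \<otimes> y \<otimes> inv g = commutator G (g \<otimes> h \<otimes> inv g) (g \<otimes> k \<otimes> inv g)"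
    unfolding y using dc h g k by (intro commutator_conj) auto
  moreover have "g \<otimes> h \<otimes> inv g \<in> derived G (carrier G)" using normal_invE(2)[OF d g h] .
  moreover have "g \<otimes> k \<otimes> inv g \<in> carrier G" using g k by simp
  ultimately show "g \<otimes> y \<otimes> inv g \<in> {commutator G h k | h k. h \<in> derived G (carrier G) \<and> k \<in> carrier G}"
    by blast
qed

lemma commutator_in_G3:
  "h \<in> derived G (carrier G) \<Longrightarrow> k \<in> carrier G \<Longrightarrow> commutator G h k \<in> G3 G"
  unfolding G3_def commutator_subgroup_def by (intro generate.incl) blast

lemma subgroup_frattini_derived:
  "subgroup (frattini (G\<lparr>carrier := derived G (carrier G)\<rparr>)) G"
  "frattini (G\<lparr>carrier := derived G (carrier G)\<rparr>) \<subseteq> derived G (carrier G)"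
proof -
  let ?D = "derived G (carrier G)"
  have D: "subgroup ?D G" by (simp add: derived_is_subgroup)
  \<comment> \<open>Inserting \<open>?D\<close> keeps the intersected family non-empty even if there
    is no maximal subgroup.\<close>
  have "frattini (G\<lparr>carrier := ?D\<rparr>) = \<Inter>(insert ?D {M. maximal_subgroup M (G\<lparr>carrier := ?D\<rparr>)})"
    by (simp add: frattini_def)
  also have "subgroup \<dots> G"
  proof (rule subgroups_Inter)
    fix M assume "M \<in> insert ?D {M. maximal_subgroup M (G\<lparr>carrier := ?D\<rparr>)}"
    then show "subgroup M G"
      using incl_subgroup[OF D] D unfolding maximal_subgroup_def by blast
  qed simp
  finally show "subgroup (frattini (G\<lparr>carrier := ?D\<rparr>)) G" .
  show "frattini (G\<lparr>carrier := ?D\<rparr>) \<subseteq> ?D" by (auto simp: frattini_def)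
qed

lemma hom_FactGroup_commutator:
  assumes "N \<lhd> G" "h \<in> carrier G" "k \<in> carrier G"
  shows "commutator (G Mod N) (N #> h) (N #> k) = N #> commutator G h k"
proof -
  interpret N: normal N G by fact
  interpret pi: group_hom G "G Mod N" "\<lambda>g. N #> g"
    by (rule group_hom.intro[OF is_group N.factorgroup_is_group group_hom_axioms.intro[OF N.r_coset_hom_Mod]])
  show ?thesis
    unfolding commutator_def using assms(2,3) by (simp only: pi.hom_mult pi.hom_inv m_closed inv_closed)
qed

end

lemma card_integer_mod_group: "n > 0 \<Longrightarrow> card (carrier (integer_mod_group n)) = n"
  by (simp add: carrier_integer_mod_group)

lemma iso_elementary_abelian_pow:
  assumes "group G" "G \<cong> integer_mod_group p \<times>\<times> integer_mod_group p" "y \<in> carrier G"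
  shows "y [^]\<^bsub>G\<^esub> p = \<one>\<^bsub>G\<^esub>"
proof -
  let ?K = "integer_mod_group p \<times>\<times> integer_mod_group p"
  have K: "group ?K" by (intro DirProd_group) simp_all
  obtain f where f: "f \<in> iso G ?K" using assms(2) by (auto simp: is_iso_def)
  then interpret f: group_hom G ?K f
    using assms(1) K by (simp add: group_hom_def group_hom_axioms_def iso_def)
  have pow: "(u, v) [^]\<^bsub>?K\<^esub> k = (u [^]\<^bsub>integer_mod_group p\<^esub> k, v [^]\<^bsub>integer_mod_group p\<^esub> k)"
    for u v and k :: nat
    by (induction k) (simp_all del: pow_integer_mod_group)
  have "f (y [^]\<^bsub>G\<^esub> p) = f y [^]\<^bsub>?K\<^esub> p" using assms(3) by (rule f.hom_nat_pow)
  also have "\<dots> = \<one>\<^bsub>?K\<^esub>" by (cases "f y") (simp add: pow)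
  finally have "f (y [^]\<^bsub>G\<^esub> p) = f \<one>\<^bsub>G\<^esub>" by simp
  moreover have "inj_on f (carrier G)" using f by (auto simp: iso_def bij_betw_def)
  moreover have "y [^]\<^bsub>G\<^esub> p \<in> carrier G" "\<one>\<^bsub>G\<^esub> \<in> carrier G"
    using assms(1,3) by (simp_all add: group.is_monoid monoid.nat_pow_closed)
  ultimately show ?thesis by (meson inj_onD)
qed

section \<open>Normal subgroups of order \<open>p\<close>, and the subgroup
  \<open>Phi(G')G_3\<close>\<close>

context prime_power_group
begin

lemma prime_order_normal_powers:
  assumes D: "subgroup D G" and card: "card D = p" and y: "y \<in> D" "y \<noteq> \<one>"
  shows "y [^] p = \<one>" and "z \<in> D \<Longrightarrow> \<exists>k::nat. z = y [^] k"
proof -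
  have Dc: "D \<subseteq> carrier G" using D subgroup.subset by blast
  then have yc: "y \<in> carrier G" using y by blast
  have "y [^]\<^bsub>G\<lparr>carrier := D\<rparr>\<^esub> order (G\<lparr>carrier := D\<rparr>) = \<one>\<^bsub>G\<lparr>carrier := D\<rparr>\<^esub>"
    using group.pow_order_eq_1[OF subgroup_imp_group[OF D]] y by simp
  then show yp: "y [^] p = \<one>"
    by (simp add: order_def card flip: nat_pow_consistent)
  have pow: "y [^] (k::nat) \<in> D" for k
    using subgroup_int_pow_closed[OF D y(1), of "int k"] by (simp add: int_pow_int)
  have "inj_on (\<lambda>k::nat. y [^] k) {..<p}"
  proof (rule inj_onI)
    fix s t assume st: "s \<in> {..<p}" "t \<in> {..<p}" and eq: "y [^] s = y [^] t"
    have "y [^] (int s - int t) = \<one>" using yc eq by (simp add: int_pow_diff int_pow_int)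
    then have "int s mod int p = int t mod int p"
      using pow_eq_one_iff[OF yc yp y(2)] by (simp add: mod_eq_dvd_iff)
    then show "s = t" using st by simp
  qed
  then have "card ((\<lambda>k::nat. y [^] k) ` {..<p}) = card D" by (simp add: card_image card)
  moreover have "(\<lambda>k::nat. y [^] k) ` {..<p} \<subseteq> D" using pow by auto
  moreover have "finite D" using Dc fin finite_subset by blast
  ultimately have "(\<lambda>k::nat. y [^] k) ` {..<p} = D" by (metis card_subset_eq)
  then show "z \<in> D \<Longrightarrow> \<exists>k::nat. z = y [^] k" by blast
qed

text \<open>Conjugation by \<open>g\<close> raises \<open>y\<close> to some power \<open>k\<close>; since \<open>g\<close> has \<open>p\<close>-power order, Fermat
  forces \<open>k\<close> to be \<open>1\<close> modulo \<open>p\<close>.\<close>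

lemma prime_order_normal_central:
  assumes D: "D \<lhd> G" and card: "card D = p" and y: "y \<in> D" and g: "g \<in> carrier G"
  shows "y \<otimes> g = g \<otimes> y"
proof (cases "y = \<one>")
  case False
  have Ds: "subgroup D G" using D normal_imp_subgroup by blast
  have yc: "y \<in> carrier G" using Ds y subgroup.subset by blast
  have yp: "y [^] p = \<one>" by (rule prime_order_normal_powers(1)[OF Ds card y False])
  have "inv g \<otimes> y \<otimes> g \<in> D" using normal.inv_op_closed1[OF D g y] .
  then obtain k :: nat where k: "inv g \<otimes> y \<otimes> g = y [^] k"
    using prime_order_normal_powers(2)[OF Ds card y False] by blast
  have yg: "y \<otimes> g = g \<otimes> y [^] k" using yc g by (simp add: k[symmetric] m_assoc inv_mult_cancel)
  have step: "y [^] (q::nat) \<otimes> g = g \<otimes> y [^] (k * q)" for q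
    using int_pow_semiconj[OF g yc _ yg, of "int q"] yc by (simp add: int_pow_int nat_pow_pow)
  have iter: "y \<otimes> g [^] (r::nat) = g [^] r \<otimes> y [^] (k ^ r)" for r
  proof (induction r)
    case 0
    show ?case using yc by simp
  next
    case (Suc r)
    have "y \<otimes> g [^] Suc r = (y \<otimes> g [^] r) \<otimes> g" using yc g by (simp add: m_assoc)
    also have "\<dots> = g [^] r \<otimes> (y [^] (k ^ r) \<otimes> g)" unfolding Suc using yc g by (simp add: m_assoc)
    also have "\<dots> = g [^] Suc r \<otimes> y [^] (k ^ Suc r)" unfolding step using yc g by (simp add: m_assoc)
    finally show ?case .
  qed
  have "g [^] (p ^ e) = \<one>" using pow_order_eq_1[OF g] by (simp add: order_eq)
  then have "y = y [^] (k ^ (p ^ e))" using iter[of "p ^ e"] yc by simp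
  then have "y [^] (int (k ^ (p ^ e)) - 1) = \<one>" using yc by (simp only: int_pow_diff int_pow_int) simp
  then have 1: "int p dvd int (k ^ (p ^ e)) - 1" using pow_eq_one_iff[OF yc yp False] by blast
  have "[k ^ p = k] (mod p)"
  proof (cases "p dvd k")
    case True
    moreover have "k dvd k ^ p" using p_gt_1 by (intro dvd_power) simp
    ultimately have "p dvd k ^ p" by (rule dvd_trans)
    then show ?thesis using True by (simp add: cong_def)
  next
    case False
    have "[k * k ^ (p - 1) = k * 1] (mod p)" using fermat_theorem[OF prime_p False] by (rule cong_scalar_left)
    moreover have "k * k ^ (p - 1) = k ^ p" using p_gt_1 by (simp flip: power_Suc)
    ultimately show ?thesis by simp
  qed
  have "[k ^ (p ^ r) = k] (mod p)" for r
  proof (induction r)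
    case (Suc r)
    have "[(k ^ (p ^ r)) ^ p = k ^ p] (mod p)" using Suc by (rule cong_pow)
    also note \<open>[k ^ p = k] (mod p)\<close>
    finally show ?case by (simp add: mult.commute flip: power_mult)
  qed simp
  from this[of e] have "[int (k ^ (p ^ e)) = int k] (mod int p)" by (simp only: cong_int_iff)
  then have "int p dvd int (k ^ (p ^ e)) - int k" by (simp add: cong_iff_dvd_diff)
  then have "int p dvd (int (k ^ (p ^ e)) - 1) - (int (k ^ (p ^ e)) - int k)" using 1 by (rule dvd_diff[rotated])
  then have "int p dvd int k - 1" by simp
  then have "y [^] (int k - 1) = \<one>" using pow_eq_one_iff[OF yc yp False] by blast
  moreover have "y [^] int k = y [^] (int k - 1) \<otimes> y [^] (1::int)"
    using int_pow_mult[OF yc, of "int k - 1" 1] by simp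
  ultimately have "y [^] k = y" using yc by (simp add: int_pow_int)
  then show ?thesis using yg by simp
qed (use g in simp)

context
  assumes card_G3: "card (G3 G) = p"
begin

lemma G3_central: "z \<in> G3 G \<Longrightarrow> g \<in> carrier G \<Longrightarrow> z \<otimes> g = g \<otimes> z"
  by (rule prime_order_normal_central[OF normal_G3 card_G3])

lemma subgroup_G3: "subgroup (G3 G) G"
  using normal_G3 normal_imp_subgroup by blast

lemma PhiG3_obtain:
  assumes "y \<in> PhiG3 G"
  obtains f z where "f \<in> frattini (G\<lparr>carrier := derived G (carrier G)\<rparr>)" "z \<in> G3 G" "y = f \<otimes> z"
    "f \<in> carrier G" "z \<in> carrier G" "f \<in> derived G (carrier G)"
  using assms subgroup.subset[OF subgroup_frattini_derived(1)] subgroup_frattini_derived(2)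
    subgroup.subset[OF subgroup_G3]
  unfolding PhiG3_def set_mult_def by blast

lemma PhiG3I:
  "f \<in> frattini (G\<lparr>carrier := derived G (carrier G)\<rparr>) \<Longrightarrow> z \<in> G3 G \<Longrightarrow> f \<otimes> z \<in> PhiG3 G"
  unfolding PhiG3_def set_mult_def by blast

text \<open>Write \<open>y = f z\<close> with \<open>f\<close> in \<open>G'\<close> and
  \<open>z\<close> in \<open>G_3\<close>. As \<open>z\<close> is central,
  \<open>[y,g] = [f,g]\<close>.\<close>

lemma commutator_PhiG3:
  assumes "y \<in> PhiG3 G" "g \<in> carrier G"
  shows "commutator G y g \<in> G3 G"
proof -
  obtain f z where fz: "z \<in> G3 G" "y = f \<otimes> z" "f \<in> carrier G" "z \<in> carrier G"
    "f \<in> derived G (carrier G)"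
    using assms(1) by (rule PhiG3_obtain)
  have K: "commutator G f g \<in> G3 G" using commutator_in_G3 fz(5) assms(2) .
  have "y \<otimes> g = f \<otimes> (z \<otimes> g)" using fz assms(2) by (simp add: m_assoc)
  also have "\<dots> = (f \<otimes> g) \<otimes> z" using fz assms(2) by (simp add: m_assoc G3_central)
  also have "\<dots> = g \<otimes> (f \<otimes> (commutator G f g \<otimes> z))"
    using fz assms(2) by (simp add: commutator_swap[of f g] m_assoc)
  also have "commutator G f g \<otimes> z = z \<otimes> commutator G f g"
    using G3_central[OF K fz(4)] .
  finally have "y \<otimes> g = g \<otimes> (y \<otimes> commutator G f g)" using fz assms(2) by (simp add: m_assoc)
  then have "commutator G y g = commutator G f g"
    using fz assms(2) by (intro commutator_eqI) simp_all
  then show ?thesis using K by simp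
qed

lemma normal_PhiG3: "PhiG3 G \<lhd> G"
proof (rule normal_invI)
  let ?F = "frattini (G\<lparr>carrier := derived G (carrier G)\<rparr>)"
  show "subgroup (PhiG3 G) G"
  proof (rule finite_closed_subgroup[OF fin])
    show "PhiG3 G \<subseteq> carrier G" by (auto elim!: PhiG3_obtain)
    show "PhiG3 G \<noteq> {}"
      using PhiG3I subgroup.one_closed[OF subgroup_frattini_derived(1)] subgroup.one_closed[OF subgroup_G3]
      by blast
    fix u v assume u: "u \<in> PhiG3 G" and v: "v \<in> PhiG3 G"
    obtain f z where fz: "f \<in> ?F" "z \<in> G3 G" "u = f \<otimes> z" "f \<in> carrier G" "z \<in> carrier G"
      using u by (rule PhiG3_obtain)
    obtain f' z' where fz': "f' \<in> ?F" "z' \<in> G3 G" "v = f' \<otimes> z'" "f' \<in> carrier G" "z' \<in> carrier G"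
      using v by (rule PhiG3_obtain)
    have "u \<otimes> v = f \<otimes> (z \<otimes> f') \<otimes> z'" using fz fz' by (simp add: m_assoc)
    also have "\<dots> = (f \<otimes> f') \<otimes> (z \<otimes> z')" using fz fz' by (simp add: m_assoc G3_central)
    also have "\<dots> \<in> PhiG3 G"
      using fz fz' subgroup.m_closed[OF subgroup_frattini_derived(1)] subgroup.m_closed[OF subgroup_G3]
      by (intro PhiG3I) blast+
    finally show "u \<otimes> v \<in> PhiG3 G" .
  qed
  then have N: "subgroup (PhiG3 G) G" .
  fix g y assume g: "g \<in> carrier G" and y: "y \<in> PhiG3 G"
  have yc: "y \<in> carrier G" using N y subgroup.subset by blast
  have "g \<otimes> y \<otimes> inv g = y \<otimes> commutator G y (inv g)"
    using g yc by (simp add: commutator_def m_assoc inv_mult_cancel)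
  moreover have "commutator G y (inv g) \<in> G3 G" using y g by (intro commutator_PhiG3) auto
  then have "\<one> \<otimes> commutator G y (inv g) \<in> PhiG3 G"
    using subgroup.one_closed[OF subgroup_frattini_derived(1)] by (intro PhiG3I)
  ultimately show "g \<otimes> y \<otimes> inv g \<in> PhiG3 G"
    using subgroup.m_closed[OF N y, of "commutator G y (inv g)"] g yc by simp
qed

end

text \<open>Everything is pulled back from quotients. First \<open><c,x>\<close> is shown to contain
  \<open>G'\<close>, which makes the coordinates span \<open>G\<close>; then the centralizer of
  \<open>G'\<close> determines the order.\<close>

lemma char_matrix_imp_class3_group:
  fixes w :: "int ^ 2 ^ 2"
  assumes "odd p" "n \<ge> m" "m \<ge> 2"
    and G3: "G\<lparr>carrier := G3 G\<rparr> \<cong> integer_mod_group p"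
    and N: "G\<lparr>carrier := PhiG3 G\<rparr> \<cong> integer_mod_group p \<times>\<times> integer_mod_group p"
    and C: "G\<lparr>carrier := centralizer G (derived G (carrier G))\<rparr> Mod PhiG3 G \<cong>
           integer_mod_group (p ^ n) \<times>\<times> (integer_mod_group (p ^ (m - 1)) \<times>\<times> integer_mod_group p)"
    and w: "char_matrix G p n m w"
  shows "\<exists>a b c x. class3_group G p e a b c x n m (w $ 1 $ 1) (w $ 1 $ 2) (w $ 2 $ 1) (w $ 2 $ 2)"
proof -
  have p0: "p > 0" using p_gt_1 by simp
  have card_G3: "card (G3 G) = p"
    using iso_same_card[OF G3] by (simp add: card_integer_mod_group p0)
  have card_N: "card (PhiG3 G) = p * p"
    using iso_same_card[OF N] by (simp add: card_cartesian_product card_integer_mod_group p0)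
  note central = G3_central[OF card_G3] and NG = normal_PhiG3[OF card_G3]
  interpret N: normal "PhiG3 G" G by (rule NG)
  interpret pi: group_hom G "G Mod PhiG3 G" "\<lambda>g. PhiG3 G #> g"
    by (rule group_hom.intro[OF is_group N.factorgroup_is_group group_hom_axioms.intro[OF N.r_coset_hom_Mod]])
  have Ns: "subgroup (PhiG3 G) G" using NG normal_imp_subgroup by blast
  have coset_one: "g \<in> PhiG3 G" if "PhiG3 G #> g = PhiG3 G" "g \<in> carrier G" for g
    using rcos_self[OF that(2) Ns] that(1) by simp
  from w obtain a b where ab: "char_generators G p n m a b"
    and pows: "a [^] (p ^ n) = commutator G a b [^] (w $ 1 $ 1 * int p) \<otimes> commutator G b (commutator G a b) [^] (w $ 1 $ 2)"
      "b [^] (p ^ m) = commutator G a b [^] (w $ 2 $ 1 * int p) \<otimes> commutator G b (commutator G a b) [^] (w $ 2 $ 2)"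
    unfolding char_matrix_def Let_def by blast
  define c where "c = commutator G a b"
  define x where "x = commutator G b c"
  have a [simp]: "a \<in> carrier G" and b [simp]: "b \<in> carrier G"
    and gen: "generate (G Mod PhiG3 G) {PhiG3 G #> a, PhiG3 G #> b} = carrier (G Mod PhiG3 G)"
    and cp: "commutator (G Mod PhiG3 G) (PhiG3 G #> a) (PhiG3 G #> b) [^]\<^bsub>G Mod PhiG3 G\<^esub> p = \<one>\<^bsub>G Mod PhiG3 G\<^esub>"
    and ac: "commutator G a c = \<one>" and x_ne: "x \<noteq> \<one>"
    using ab unfolding char_generators_def Let_def c_def x_def by blast+
  have c [simp]: "c \<in> carrier G" by (simp add: c_def)
  have x [simp]: "x \<in> carrier G" by (simp add: x_def)
  have cD: "c \<in> derived G (carrier G)" unfolding c_def by (rule commutator_in_derived) simp_all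
  have "inv (commutator G c b) \<in> G3 G"
    using subgroup.m_inv_closed[OF subgroup_G3[OF card_G3] commutator_in_G3[OF cD b]] .
  then have xG3: "x \<in> G3 G" by (simp add: commutator_inverse x_def)
  have xz: "x \<otimes> g = g \<otimes> x" if "g \<in> carrier G" for g using central[OF xG3 that] .
  have xp: "x [^] p = \<one>"
    by (rule prime_order_normal_powers(1)[OF subgroup_G3[OF card_G3] card_G3 xG3 x_ne])
  have cpN: "c [^] p \<in> PhiG3 G"
  proof (rule coset_one)
    have "PhiG3 G #> (c [^] p) = (PhiG3 G #> c) [^]\<^bsub>G Mod PhiG3 G\<^esub> p"
      by (rule pi.hom_nat_pow) simp
    also have "\<dots> = PhiG3 G"
      using cp hom_FactGroup_commutator[OF NG a b] by (simp add: c_def)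
    finally show "PhiG3 G #> (c [^] p) = PhiG3 G" .
  qed simp
  \<comment> \<open>The image of \<open>c\<close> has order dividing \<open>p\<close>, so
    \<open>c^p\<close> lies in \<open>Phi(G')G_3\<close>, which has exponent \<open>p\<close>. This
    bounds the order of \<open>c\<close> by \<open>p^2\<close>.\<close>
  have "(c [^] p) [^]\<^bsub>G\<lparr>carrier := PhiG3 G\<rparr>\<^esub> p = \<one>\<^bsub>G\<lparr>carrier := PhiG3 G\<rparr>\<^esub>"
    using subgroup_imp_group[OF Ns] N cpN by (intro iso_elementary_abelian_pow) simp_all
  then have "(c [^] p) [^] p = \<one>" by (simp flip: nat_pow_consistent)
  then have cpp: "c [^] (int p)\<^sup>2 = \<one>"
    by (simp add: nat_pow_pow power2_eq_square int_pow_int flip: of_nat_mult)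
  interpret class3_relations G p e a b c x
  proof
    show "a \<otimes> b = b \<otimes> (a \<otimes> c)" unfolding c_def by (rule commutator_swap) simp_all
    show "a \<otimes> c = c \<otimes> a" using ac commutator_eq_one_iff[of a c] by simp
    have "(b \<otimes> c) = (c \<otimes> b) \<otimes> x"
      unfolding x_def using commutator_swap[of b c] by (simp add: m_assoc)
    then have "c \<otimes> b = (b \<otimes> c) \<otimes> inv x" by (simp add: inv_solve_right)
    then show "c \<otimes> b = b \<otimes> (c \<otimes> inv x)" by (simp add: m_assoc)
    show "x [^] int p = \<one>" using xp by (simp add: int_pow_int)
  qed (use assms(1) xz cpp in simp_all)
  define D where "D = {E 0 0 k l | k l. True}"
  have D_mem: "E 0 0 k l \<in> D" for k l unfolding D_def by blast
  have Ds: "subgroup D G"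
  proof (rule finite_closed_subgroup[OF fin])
    fix u v assume "u \<in> D" "v \<in> D"
    then show "u \<otimes> v \<in> D" unfolding D_def using E_mult_0 by fastforce
  qed (use D_mem in \<open>auto simp: D_def\<close>)
  have G3D: "G3 G \<subseteq> D"
  proof
    fix z assume "z \<in> G3 G"
    then obtain k :: nat where "z = x [^] k"
      using prime_order_normal_powers(2)[OF subgroup_G3[OF card_G3] card_G3 xG3 x_ne] by blast
    then have "z = E 0 0 0 (int k)" by (simp add: E_simps int_pow_int)
    then show "z \<in> D" using D_mem by simp
  qed
  have cinD: "c \<in> D" using D_mem[of 1 0] by (simp add: E_gens)
  \<comment> \<open>A conjugate of \<open>c\<close> is \<open>c\<close> times a commutator in
    \<open>G_3\<close>, and \<open>G_3\<close> is generated by the central element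
    \<open>x\<close>.\<close>
  have DN: "D \<lhd> G"
  proof (rule normal_invI[OF Ds])
    fix g y assume g: "g \<in> carrier G" and "y \<in> D"
    then obtain k l where "y = E 0 0 k l" unfolding D_def by blast
    then have y: "y = c [^] k \<otimes> x [^] l" by (simp only: E_simps)
    have "c \<otimes> commutator G c (inv g) \<in> D"
      using subgroup.m_closed[OF Ds cinD] commutator_in_G3[OF cD] G3D g by blast
    moreover have "c \<otimes> commutator G c (inv g) = g \<otimes> c \<otimes> inv g"
      using g by (simp add: commutator_def m_assoc inv_mult_cancel)
    ultimately have gc: "g \<otimes> c \<otimes> inv g \<in> D" by simp
    have 1: "(g \<otimes> c \<otimes> inv g) [^] k \<otimes> g = g \<otimes> c [^] k"
      using g by (intro int_pow_semiconj) (simp_all add: m_assoc)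
    have 2: "x [^] l \<otimes> inv g = inv g \<otimes> x [^] l"
      using g xz[of "inv g"] by (intro int_pow_semiconj) simp_all
    have "g \<otimes> y \<otimes> inv g = (g \<otimes> c [^] k) \<otimes> (x [^] l \<otimes> inv g)"
      using g unfolding y by (simp add: m_assoc)
    also have "\<dots> = (g \<otimes> c \<otimes> inv g) [^] k \<otimes> (g \<otimes> (inv g \<otimes> x [^] l))"
      unfolding 1[symmetric] 2 using g by (simp add: m_assoc)
    also have "\<dots> = (g \<otimes> c \<otimes> inv g) [^] k \<otimes> x [^] l"
      using g by (simp add: inv_mult_cancel)
    also have "\<dots> \<in> D"
      using subgroup.m_closed[OF Ds subgroup_int_pow_closed[OF Ds gc] D_mem[of 0 l]] by (simp add: E_simps)
    finally show "g \<otimes> y \<otimes> inv g \<in> D" .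
  qed
  interpret D: normal D G by (rule DN)
  interpret rho: group_hom G "G Mod D" "\<lambda>g. D #> g"
    by (rule group_hom.intro[OF is_group D.factorgroup_is_group group_hom_axioms.intro[OF D.r_coset_hom_Mod]])
  \<comment> \<open>Since \<open>a\<close> and \<open>b\<close> generate modulo
    \<open>Phi(G')G_3\<close>, this serves as an induction principle for \<open>G\<close>: it is
    applied both to centralizers modulo \<open>D\<close> and to \<open>T\<close>.\<close>
  have span: "K = carrier G" if K: "subgroup K G" "PhiG3 G \<subseteq> K" "a \<in> K" "b \<in> K" for K
  proof
    show "K \<subseteq> carrier G" using K(1) subgroup.subset by blast
    show "carrier G \<subseteq> K"
    proof
      fix g assume g: "g \<in> carrier G"
      then have "PhiG3 G #> g \<in> carrier (G Mod PhiG3 G)" by (auto simp: carrier_FactGroup)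
      also have "carrier (G Mod PhiG3 G) = (\<lambda>g. PhiG3 G #> g) ` generate G {a, b}"
        using gen pi.generate_img[of "{a, b}"] by simp
      finally obtain t where t: "t \<in> generate G {a, b}" "PhiG3 G #> g = PhiG3 G #> t" by blast
      have "t \<in> K" using t(1) generate_subgroup_incl[of "{a, b}" K] K by blast
      moreover have "g \<in> PhiG3 G #> t" using rcos_self[OF g Ns] t(2) by simp
      ultimately show "g \<in> K" using K subgroup.m_closed[OF K(1)] by (auto simp: r_coset_def)
    qed
  qed
  let ?r = "\<lambda>g. D #> g"
  have comm_iff: "commutator G g h \<in> D \<longleftrightarrow> ?r g \<otimes>\<^bsub>G Mod D\<^esub> ?r h = ?r h \<otimes>\<^bsub>G Mod D\<^esub> ?r g"
    if gh: "g \<in> carrier G" "h \<in> carrier G" for g h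
  proof -
    have "commutator G g h \<in> D \<longleftrightarrow> ?r (commutator G g h) = D"
    proof
      show "commutator G g h \<in> D \<Longrightarrow> ?r (commutator G g h) = D"
        by (rule coset_join2[OF commutator_closed[OF gh] Ds])
      assume "?r (commutator G g h) = D"
      then show "commutator G g h \<in> D" using rcos_self[OF commutator_closed[OF gh] Ds] by (simp only:)
    qed
    also have "\<dots> \<longleftrightarrow> commutator (G Mod D) (?r g) (?r h) = \<one>\<^bsub>G Mod D\<^esub>"
      by (simp only: hom_FactGroup_commutator[OF DN gh] one_FactGroup)
    also have "\<dots> \<longleftrightarrow> ?r g \<otimes>\<^bsub>G Mod D\<^esub> ?r h = ?r h \<otimes>\<^bsub>G Mod D\<^esub> ?r g"
      using gh by (intro rho.H.commutator_eq_one_iff rho.hom_closed)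
    finally show ?thesis .
  qed
  \<comment> \<open>The elements commuting with \<open>h\<close> modulo \<open>D\<close> form a
    subgroup. It contains \<open>Phi(G')G_3\<close>, whose commutators lie in \<open>G_3\<close> and
    hence in \<open>D\<close>.\<close>
  have all: "\<forall>g\<in>carrier G. commutator G g h \<in> D"
    if h: "h \<in> carrier G" and ah: "commutator G a h \<in> D" and bh: "commutator G b h \<in> D" for h
  proof -
    let ?C = "{g \<in> carrier G. commutator G g h \<in> D}"
    have one: "\<one> \<in> ?C" using h subgroup.one_closed[OF Ds] by (simp add: commutator_def)
    have "?C = carrier G"
    proof (rule span)
      show "subgroup ?C G"
      proof (rule finite_closed_subgroup[OF fin])
        show "?C \<noteq> {}" using one by blast
        fix u v assume "u \<in> ?C" "v \<in> ?C"
        then have u: "u \<in> carrier G" "commutator G u h \<in> D" and v: "v \<in> carrier G" "commutator G v h \<in> D"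
          by simp_all
        have uv: "?r u \<in> carrier (G Mod D)" "?r v \<in> carrier (G Mod D)" "?r h \<in> carrier (G Mod D)"
          using rho.hom_closed[OF u(1)] rho.hom_closed[OF v(1)] rho.hom_closed[OF h] .
        have 1: "?r u \<otimes>\<^bsub>G Mod D\<^esub> ?r h = ?r h \<otimes>\<^bsub>G Mod D\<^esub> ?r u"
          using comm_iff[OF u(1) h] u(2) by blast
        have 2: "?r v \<otimes>\<^bsub>G Mod D\<^esub> ?r h = ?r h \<otimes>\<^bsub>G Mod D\<^esub> ?r v"
          using comm_iff[OF v(1) h] v(2) by blast
        have "?r (u \<otimes> v) \<otimes>\<^bsub>G Mod D\<^esub> ?r h = ?r h \<otimes>\<^bsub>G Mod D\<^esub> ?r (u \<otimes> v)"
          unfolding rho.hom_mult[OF u(1) v(1)] by (metis 1 2 uv rho.H.m_assoc)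
        then have "commutator G (u \<otimes> v) h \<in> D" using comm_iff[OF _ h, of "u \<otimes> v"] u v by blast
        then show "u \<otimes> v \<in> ?C" using u v by blast
      qed blast
      show "PhiG3 G \<subseteq> ?C"
        using commutator_PhiG3[OF card_G3 _ h] G3D subgroup.subset[OF Ns] by blast
    qed (use ah bh in auto)
    then show ?thesis by blast
  qed
  have sym: "commutator G h g \<in> D" if "commutator G g h \<in> D" "g \<in> carrier G" "h \<in> carrier G" for g h
    using subgroup.m_inv_closed[OF Ds that(1)] by (simp only: commutator_inverse that)
  have self: "commutator G g g \<in> D" if "g \<in> carrier G" for g
    using subgroup.one_closed[OF Ds] commutator_eq_one_iff[OF that that] by metis
  have abD: "commutator G a b \<in> D" using cinD unfolding c_def .
  \<comment> \<open>Because \<open>[a,b] = c\<close> lies in \<open>D\<close>, first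
    \<open>a\<close> and \<open>b\<close> become central modulo \<open>D\<close>; a further use of
    \<open>all\<close> then makes every element central, so \<open>G/D\<close> is abelian.\<close>
  have Ga: "\<forall>g\<in>carrier G. commutator G g a \<in> D"
    using all[OF a self[OF a] sym[OF abD a b]] .
  have Gb: "\<forall>g\<in>carrier G. commutator G g b \<in> D"
    using all[OF b abD self[OF b]] .
  have allD: "commutator G g h \<in> D" if "g \<in> carrier G" "h \<in> carrier G" for g h
    using all[OF that(2) sym[OF bspec[OF Ga that(2)] that(2) a] sym[OF bspec[OF Gb that(2)] that(2) b]] that(1) by blast
  have "derived_set G (carrier G) \<subseteq> D"
  proof
    fix y assume "y \<in> derived_set G (carrier G)"
    then obtain h1 h2 where h: "h1 \<in> carrier G" "h2 \<in> carrier G" and y: "y = h1 \<otimes> h2 \<otimes> inv h1 \<otimes> inv h2"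
      by blast
    have "y = commutator G (inv h1) (inv h2)" using h by (simp add: y commutator_def)
    then show "y \<in> D" using allD[of "inv h1" "inv h2"] h by simp
  qed
  then have derD: "derived G (carrier G) \<subseteq> D"
    unfolding derived_def using generate_subgroup_incl[OF _ Ds] by blast
  have ND: "PhiG3 G \<subseteq> D"
  proof
    fix y assume "y \<in> PhiG3 G"
    then obtain f z where fz: "z \<in> G3 G" "y = f \<otimes> z" "f \<in> derived G (carrier G)"
      by (rule PhiG3_obtain[OF card_G3])
    have "f \<in> D" "z \<in> D" using fz derD G3D by blast+
    then show "y \<in> D" unfolding fz(2) by (rule subgroup.m_closed[OF Ds])
  qed
  have "D \<subseteq> T" unfolding D_def using gens_in_T(5) by blast
  then have T: "T = carrier G"
    using ND gens_in_T by (intro span[OF subgroup_T]) blast+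
  interpret class3_powers G p e a b c x n m "w $ 1 $ 1" "w $ 1 $ 2" "w $ 2 $ 1" "w $ 2 $ 2"
  proof
    show "a [^] (int p ^ n) = c [^] (w $ 1 $ 1 * int p) \<otimes> x [^] (w $ 1 $ 2)"
      "b [^] (int p ^ m) = c [^] (w $ 2 $ 1 * int p) \<otimes> x [^] (w $ 2 $ 2)"
      using pows unfolding c_def[symmetric] x_def[symmetric] by (simp_all flip: int_pow_int)
  qed (use assms T in simp_all)
  let ?Z = "centralizer G (derived G (carrier G))"
  have Zs: "subgroup ?Z G"
  proof (rule finite_closed_subgroup[OF fin])
    have dc: "derived G (carrier G) \<subseteq> carrier G" by (simp add: derived_in_carrier)
    then show "?Z \<noteq> {}" unfolding centralizer_def by (auto intro!: exI[of _ \<one>])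
    fix u v assume u: "u \<in> ?Z" and v: "v \<in> ?Z"
    have "u \<otimes> v \<otimes> h = h \<otimes> (u \<otimes> v)" if "h \<in> derived G (carrier G)" for h
    proof -
      have "h \<in> carrier G" "u \<in> carrier G" "v \<in> carrier G" "u \<otimes> h = h \<otimes> u" "v \<otimes> h = h \<otimes> v"
        using that u v dc unfolding centralizer_def by blast+
      then show ?thesis by (metis m_assoc)
    qed
    then show "u \<otimes> v \<in> ?Z" using u v unfolding centralizer_def by simp
  qed (auto simp: centralizer_def)
  have NZ: "PhiG3 G \<subseteq> ?Z"
  proof
    fix y assume y: "y \<in> PhiG3 G"
    have "y \<otimes> h = h \<otimes> y" if hD: "h \<in> derived G (carrier G)" for h
    proof -
      obtain k l where "y = E 0 0 k l" using subsetD[OF ND y] unfolding D_def by blast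
      moreover obtain k' l' where "h = E 0 0 k' l'" using subsetD[OF derD hD] unfolding D_def by blast
      ultimately show ?thesis by (simp only: E_mult_0 add.commute)
    qed
    moreover have "y \<in> carrier G" using subgroup.subset[OF Ns] y by blast
    ultimately show "y \<in> ?Z" unfolding centralizer_def by blast
  qed
  have "b \<notin> ?Z"
    using x_ne cD commutator_eq_one_iff[OF b c] unfolding centralizer_def x_def by blast
  then have ZG: "?Z \<noteq> carrier G" using b by blast
  have "card (rcosets\<^bsub>G\<lparr>carrier := ?Z\<rparr>\<^esub> (PhiG3 G)) * card (PhiG3 G) = order (G\<lparr>carrier := ?Z\<rparr>)"
    by (rule group.lagrange[OF subgroup_imp_group[OF Zs] subgroup_incl[OF Ns Zs NZ]])
  moreover have "card (rcosets\<^bsub>G\<lparr>carrier := ?Z\<rparr>\<^esub> (PhiG3 G)) = p ^ n * (p ^ (m - 1) * p)"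
    using iso_same_card[OF C] p0
    by (simp add: FactGroup_def card_cartesian_product card_integer_mod_group)
  ultimately have "card ?Z = p ^ n * (p ^ (m - 1) * p) * (p * p)"
    by (simp add: card_N order_def)
  also have "\<dots> = p ^ (n + m + 2)"
    using assms(3) by (simp add: power_add power2_eq_square flip: power_Suc2)
  finally have cZ: "card ?Z = p ^ (n + m + 2)" .
  obtain k where k: "subgroup_index G ?Z = p ^ k" using index_prime_power[OF Zs] .
  have ek: "p ^ k * p ^ (n + m + 2) = p ^ e" using index_mult_card[OF Zs] by (simp only: k cZ order_eq)
  \<comment> \<open>The centralizer is proper, so its index is at least \<open>p\<close>; the bound
    \<open>order_le\<close> allows no more than \<open>p\<close>. Together they fix
    \<open>e\<close>.\<close>
  have "k \<noteq> 0"
  proof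
    assume "k = 0"
    then have "card ?Z = card (carrier G)" using ek order_eq cZ by (simp add: order_def)
    then show False using ZG subgroup.subset[OF Zs] fin card_subset_eq by blast
  qed
  moreover have "p ^ e = p ^ (k + (n + m + 2))" using ek by (simp only: power_add[of p k])
  then have "e = k + (n + m + 2)" using p_gt_1 by (simp only: power_inject_exp)
  moreover have "e \<le> n + m + 3" using order_le p_gt_1 by (simp add: order_eq)
  ultimately have "e = n + m + 3" by simp
  then have "class3_group G p e a b c x n m (w $ 1 $ 1) (w $ 1 $ 2) (w $ 2 $ 1) (w $ 2 $ 2)"
    by unfold_locales
  then show ?thesis by blast
qed

end

theorem theorem5p1:
  fixes G :: "('a, 'b) monoid_scheme" and p n m :: nat and w :: "int ^ 2 ^ 2"
  assumes "Factorial_Ring.prime p" and "odd p"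
    and "finite_p_group p G"
    and "n \<ge> m" and "m \<ge> 2"
    and "G\<lparr>carrier := G3 G\<rparr> \<cong> integer_mod_group p"
    and "G\<lparr>carrier := PhiG3 G\<rparr> \<cong> integer_mod_group p \<times>\<times> integer_mod_group p"
    and "G Mod PhiG3 G \<cong> M_group p n m"
    and "G\<lparr>carrier := centralizer G (derived G (carrier G))\<rparr> Mod PhiG3 G \<cong>
           integer_mod_group (p ^ n) \<times>\<times> (integer_mod_group (p ^ (m - 1)) \<times>\<times> integer_mod_group p)"
    and "char_matrix G p n m w"
  shows "(I_min p G \<ge> 2 \<and> \<not> (\<exists>H. A1_subgroup p H G \<and> subgroup_index G H = p)) \<and>
    I_max p G \<ge> n \<and>
    (I_max p G = 2 \<longleftrightarrow>
       n = 2 \<and> m = 2 \<and>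
       (([w $ 1 $ 1 = 0] (mod int p) \<and> [w $ 1 $ 2 = 0] (mod int p) \<and>
           \<not> [w $ 2 $ 2 = 0] (mod int p)) \<or>
        \<not> QuadRes (int p) ((w $ 1 $ 1)\<^sup>2 - 4 * w $ 1 $ 2)))"
proof -
  from assms(3) obtain e where "group G" "finite (carrier G)" "order G = p ^ e"
    by (auto simp: finite_p_group_def)
  then interpret prime_power_group G p e
    using assms(1) by (simp add: prime_power_group_def prime_power_group_axioms_def)
  obtain a b c x where
    "class3_group G p e a b c x n m (w $ 1 $ 1) (w $ 1 $ 2) (w $ 2 $ 1) (w $ 2 $ 2)"
    using char_matrix_imp_class3_group[OF assms(2,4,5,6,7,9,10)] by blast
  then interpret class3_group G p e a b c x n m "w $ 1 $ 1" "w $ 1 $ 2" "w $ 2 $ 1" "w $ 2 $ 2" .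
  show ?thesis
    unfolding cong_0_iff using I_min_I_max by blast
qed

end
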